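(* There is an algorithm which, given a positive semidefinite matrix $L\in\mathbb{R}^{m\times m}$, a cost vector $c\in\mathbb{Z}^m$ and a value $C\in\mathbb{Z}$, samples a set $S\subseteq[m]$ of cost $c(S)\le C$ with probability proportional to $\det(L_{S,S})$; that is, each $S\subseteq [m]$ with $c(S)\le C$ is output with probability $\det(L_{S,S})\big/\sum_{T\subseteq[m]:\,c(T)\le C}\det(L_{T,T})$. The running time of the algorithm is polynomial in $m$ and $\|c\|_1$.
   Context: $[m]=\{1,\dots,m\}$; $c(S)=\sum_{i\in S}c_i$ and $\|c\|_1=\sum_i|c_i|$. $L_{S,S}$ is the principal submatrix of $L$ with rows and columns in $S$, and $\det(L_{\emptyset,\emptyset})=1$. Running time counts exact real arithmetic operations, and tosses of a coin with a computed bias in $[0,1]$, at unit cost. The sampling problem is considered only for inputs for which the normalizing sum is positive. *)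

theory Defs
  imports
    "HOL-Probability.Probability_Mass_Function"
    "HOL-Computational_Algebra.Polynomial"
    "Jordan_Normal_Form.Determinant"
    "Jordan_Normal_Form.DL_Submatrix"
begin

section \<open>Constrained determinantal distributions\<close>

text \<open>
  The ground set with \<open>m\<close> elements is \<open>{..<m}\<close>, matching the indexing of matrices and vectors
  from 0.
\<close>

definition positive_semidefinite :: "real mat \<Rightarrow> bool" where
  "positive_semidefinite L \<longleftrightarrow>
     square_mat L \<and> transpose_mat L = L \<and>
     (\<forall>x \<in> carrier_vec (dim_row L). 0 \<le> scalar_prod x (mult_mat_vec L x))"

definition principal_minor :: "real mat \<Rightarrow> nat set \<Rightarrow> real" where
  "principal_minor L S = Determinant.det (submatrix L S S)"

lemma principal_minor_empty: "principal_minor L {} = 1"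
  by (simp add: principal_minor_def submatrix_def)

definition set_cost :: "int vec \<Rightarrow> nat set \<Rightarrow> int" where
  "set_cost c S = (\<Sum>i\<in>S. vec_index c i)"

definition norm1 :: "int vec \<Rightarrow> nat" where
  "norm1 c = nat (\<Sum>i<dim_vec c. \<bar>vec_index c i\<bar>)"

definition feasible_sets :: "int vec \<Rightarrow> int \<Rightarrow> nat set set" where
  "feasible_sets c C = {S. S \<subseteq> {..<dim_vec c} \<and> set_cost c S \<le> C}"

definition normalizing_sum :: "real mat \<Rightarrow> int vec \<Rightarrow> int \<Rightarrow> real" where
  "normalizing_sum L c C = (\<Sum>T\<in>feasible_sets c C. principal_minor L T)"


section \<open>Randomized programs over the reals\<close>

text \<open>
  Algorithms are finite imperative programs over a store that holds integers (used for counters and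
  addresses) and reals, in zero- or higher-dimensional arrays indexed by integers.  The available
  operations are field arithmetic and comparison on reals, ring arithmetic and comparison on
  integers, and the embedding of the integers into the reals.  There is no rounding of reals and no
  integer division, and a program text contains no real constants other than those built from
  integers, so that nothing can be precomputed into it.  As usual in HOL, \<open>x / 0 = 0\<close>.
\<close>

type_synonym vname = string

datatype iexp =
    IConst int
  | IVar vname "iexp list"
  | IAdd iexp iexp
  | ISub iexp iexp
  | IMul iexp iexp

datatype rexp =
    ROfInt iexp
  | RVar vname "iexp list"
  | RAdd rexp rexp
  | RSub rexp rexp
  | RMul rexp rexp
  | RDiv rexp rexp

datatype bexp =
    ILess iexp iexp
  | RLess rexp rexp
  | BNeg bexp
  | BConj bexp bexp

datatype com =
    Skip
  | IAssign vname "iexp list" iexp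
  | RAssign vname "iexp list" rexp
  | Toss vname "iexp list" rexp
  | Seq com com
  | Cond bexp com com
  | Loop bexp com

record store =
  ints :: "vname \<Rightarrow> int list \<Rightarrow> int"
  reals :: "vname \<Rightarrow> int list \<Rightarrow> real"

fun ival :: "store \<Rightarrow> iexp \<Rightarrow> int" where
  "ival s (IConst n) = n"
| "ival s (IVar x es) = ints s x (map (ival s) es)"
| "ival s (IAdd a b) = ival s a + ival s b"
| "ival s (ISub a b) = ival s a - ival s b"
| "ival s (IMul a b) = ival s a * ival s b"

fun rval :: "store \<Rightarrow> rexp \<Rightarrow> real" where
  "rval s (ROfInt a) = of_int (ival s a)"
| "rval s (RVar x es) = reals s x (map (ival s) es)"
| "rval s (RAdd a b) = rval s a + rval s b"
| "rval s (RSub a b) = rval s a - rval s b"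
| "rval s (RMul a b) = rval s a * rval s b"
| "rval s (RDiv a b) = rval s a / rval s b"

fun bval :: "store \<Rightarrow> bexp \<Rightarrow> bool" where
  "bval s (ILess a b) = (ival s a < ival s b)"
| "bval s (RLess a b) = (rval s a < rval s b)"
| "bval s (BNeg b) = (\<not> bval s b)"
| "bval s (BConj a b) = (bval s a \<and> bval s b)"

definition iupdate :: "vname \<Rightarrow> int list \<Rightarrow> int \<Rightarrow> store \<Rightarrow> store" where
  "iupdate x is v s = s\<lparr>ints := (ints s)(x := (ints s x)(is := v))\<rparr>"

definition rupdate :: "vname \<Rightarrow> int list \<Rightarrow> real \<Rightarrow> store \<Rightarrow> store" where
  "rupdate x is v s = s\<lparr>reals := (reals s)(x := (reals s x)(is := v))\<rparr>"

text \<open>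
  Every constant, memory access, operation and comparison that is evaluated costs one unit, and so
  does every assignment and coin toss.
\<close>

fun icost :: "iexp \<Rightarrow> nat" where
  "icost (IConst n) = 1"
| "icost (IVar x es) = 1 + sum_list (map icost es)"
| "icost (IAdd a b) = 1 + icost a + icost b"
| "icost (ISub a b) = 1 + icost a + icost b"
| "icost (IMul a b) = 1 + icost a + icost b"

fun rcost :: "rexp \<Rightarrow> nat" where
  "rcost (ROfInt a) = 1 + icost a"
| "rcost (RVar x es) = 1 + sum_list (map icost es)"
| "rcost (RAdd a b) = 1 + rcost a + rcost b"
| "rcost (RSub a b) = 1 + rcost a + rcost b"
| "rcost (RMul a b) = 1 + rcost a + rcost b"
| "rcost (RDiv a b) = 1 + rcost a + rcost b"

fun bcost :: "bexp \<Rightarrow> nat" where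
  "bcost (ILess a b) = 1 + icost a + icost b"
| "bcost (RLess a b) = 1 + rcost a + rcost b"
| "bcost (BNeg b) = 1 + bcost b"
| "bcost (BConj a b) = 1 + bcost a + bcost b"

definition charge :: "nat \<Rightarrow> (store \<times> nat) pmf \<Rightarrow> (store \<times> nat) pmf" where
  "charge k = map_pmf (\<lambda>(s, t). (s, k + t))"

definition and_then :: "(store \<times> nat) pmf \<Rightarrow> (store \<Rightarrow> (store \<times> nat) pmf) \<Rightarrow> (store \<times> nat) pmf" where
  "and_then D K = bind_pmf D (\<lambda>(s, t). charge t (K s))"

text \<open>
  \<open>exec p s D\<close>: started in \<open>s\<close>, the program \<open>p\<close> terminates for all outcomes of its coin tosses, and
  \<open>D\<close> is the joint distribution of the final store and the running time.  Tossing a coin whose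
  bias is outside \<open>[0, 1]\<close> is an error: there is no rule for it, and hence no \<open>D\<close> for a program
  that may reach such a toss.  Outcomes of probability 0 (not in \<open>set_pmf\<close>) are ignored.
\<close>

inductive exec :: "com \<Rightarrow> store \<Rightarrow> (store \<times> nat) pmf \<Rightarrow> bool" where
  Skip: "exec Skip s (return_pmf (s, 1))"
| IAssign: "exec (IAssign x es a) s
     (return_pmf (iupdate x (map (ival s) es) (ival s a) s, 1 + sum_list (map icost es) + icost a))"
| RAssign: "exec (RAssign x es a) s
     (return_pmf (rupdate x (map (ival s) es) (rval s a) s, 1 + sum_list (map icost es) + rcost a))"
| Toss: "0 \<le> rval s a \<Longrightarrow> rval s a \<le> 1 \<Longrightarrow>
     exec (Toss x es a) s
       (map_pmf (\<lambda>b. (iupdate x (map (ival s) es) (of_bool b) s,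
                      1 + sum_list (map icost es) + rcost a))
          (bernoulli_pmf (rval s a)))"
| Seq: "exec p s D \<Longrightarrow> (\<And>s' t. (s', t) \<in> set_pmf D \<Longrightarrow> exec q s' (K s')) \<Longrightarrow>
     exec (Seq p q) s (and_then D K)"
| CondTrue: "bval s b \<Longrightarrow> exec p s D \<Longrightarrow> exec (Cond b p q) s (charge (bcost b) D)"
| CondFalse: "\<not> bval s b \<Longrightarrow> exec q s D \<Longrightarrow> exec (Cond b p q) s (charge (bcost b) D)"
| LoopFalse: "\<not> bval s b \<Longrightarrow> exec (Loop b p) s (return_pmf (s, bcost b))"
| LoopTrue: "bval s b \<Longrightarrow> exec p s D \<Longrightarrow>
     (\<And>s' t. (s', t) \<in> set_pmf D \<Longrightarrow> exec (Loop b p) s' (K s')) \<Longrightarrow>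
     exec (Loop b p) s (charge (bcost b) (and_then D K))"

lemma and_then_cong:
  assumes "\<And>s t. (s, t) \<in> set_pmf D \<Longrightarrow> K s = K' s"
  shows "and_then D K = and_then D K'"
  unfolding and_then_def by (rule bind_pmf_cong) (auto simp: assms)

theorem exec_deterministic: "exec p s D \<Longrightarrow> exec p s D' \<Longrightarrow> D = D'"
proof (induction arbitrary: D' rule: exec.induct)
  case (Seq p s D q K)
  from Seq.prems obtain D1 K1 where
    D1: "D' = and_then D1 K1" "exec p s D1"
      "\<And>s' t. (s', t) \<in> set_pmf D1 \<Longrightarrow> exec q s' (K1 s')"
    by (cases rule: exec.cases) auto
  have "D = D1" using Seq.IH(1) D1(2) by blast
  then show ?case unfolding D1(1) using Seq.IH(2) D1(3) by (auto intro!: and_then_cong)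
next
  case (LoopTrue s b p D K)
  from LoopTrue.prems LoopTrue.hyps(1) obtain D1 K1 where
    D1: "D' = charge (bcost b) (and_then D1 K1)" "exec p s D1"
      "\<And>s' t. (s', t) \<in> set_pmf D1 \<Longrightarrow> exec (Loop b p) s' (K1 s')"
    by (cases rule: exec.cases) auto
  have "D = D1" using LoopTrue.IH(1) D1(2) by blast
  then have "and_then D K = and_then D1 K1"
    using LoopTrue.IH(2) D1(3) by (auto intro!: and_then_cong)
  then show ?case unfolding D1(1) by simp
qed (erule exec.cases; auto)+


section \<open>Input, output and running time of the sampling problem\<close>

definition input_store :: "real mat \<Rightarrow> int vec \<Rightarrow> int \<Rightarrow> store" where
  "input_store L c C =
     \<lparr>ints = (\<lambda>x is.
        if x = ''m'' \<and> is = [] then int (dim_vec c)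
        else if x = ''C'' \<and> is = [] then C
        else if x = ''c'' then
          (case is of [i] \<Rightarrow> if 0 \<le> i \<and> i < int (dim_vec c) then vec_index c (nat i) else 0 | _ \<Rightarrow> 0)
        else 0),
      reals = (\<lambda>x is.
        if x = ''L'' then
          (case is of
             [i, j] \<Rightarrow> if 0 \<le> i \<and> i < int (dim_row L) \<and> 0 \<le> j \<and> j < int (dim_col L)
                       then L $$ (nat i, nat j) else 0
           | _ \<Rightarrow> 0)
        else 0)\<rparr>"

text \<open>The output set is read off its indicator vector in the integer array \<open>S\<close>.\<close>

definition output_set :: "nat \<Rightarrow> store \<Rightarrow> nat set" where
  "output_set m s = {i. i < m \<and> ints s ''S'' [int i] = 1}"

text \<open>A bivariate polynomial is a polynomial in the second variable over polynomials in the first.\<close>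

definition poly2 :: "nat poly poly \<Rightarrow> nat \<Rightarrow> nat \<Rightarrow> nat" where
  "poly2 P x y = poly (poly P [:y:]) x"

end

theory Submission
  imports Defs "Jordan_Normal_Form.Char_Poly" "HOL-Computational_Algebra.Formal_Power_Series"
begin

text \<open>
  The elements are decided one after the other.  Once a prefix has been decided, with included
  set \<open>A\<close>, the next element is included with the conditional probability given by the total
  weights of the feasible sets that extend either choice; these conditional probabilities
  telescope to the target distribution.

  A total weight is read off the power series \<open>det (I + D L)\<close>, where \<open>D\<close> is diagonal with powers
  of \<open>X\<close> as entries: it is the sum of the principal minors of all sets \<open>T\<close>, each multiplied by
  the product of the entries of \<open>D\<close> in \<open>T\<close>.
  Exponents are the costs shifted by digits of a mixed radix system that count the undecided and
  the decided elements of \<open>T\<close>, which makes them positive and encodes both the cost of \<open>T\<close> and whether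
  \<open>T\<close> contains \<open>A\<close>.  Rows of excluded elements get the entry 0.  Because all exponents are positive,
  the matrix is the identity modulo \<open>X\<close>, so Gaussian elimination over truncated power
  series needs no pivoting: every pivot has constant term 1.  Positive semidefiniteness only
  matters for the weights to be nonnegative.
\<close>

text \<open>Conditioning on \<open>A\<close> by marked exponents avoids dividing by the minor of
  \<open>A\<close>, which can be 0. Counting is enough for it: among the sets whose decided part
  lies in \<open>A\<close>, those that contain \<open>A\<close> are recognized by the number of
  their decided elements. A separate digit for every element would make the degree exponential.
  Negative costs have to be shifted to become exponents, but a shift contributes in proportion to
  the size of \<open>T\<close>, which is unknown. With shifts that are multiples of
  \<open>2 * norm1 c + 1\<close>, the length of the range of possible total costs, this size can be
  separated from the cost again. Truncation loses nothing: each coefficient below \<open>N\<close>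
  of a sum, product or inverse of power series depends only on coefficients below \<open>N\<close>,
  and no exponent reaches \<open>N\<close>. Inverting a series with constant term 1 needs no
  division of reals, so no zero test on computed values occurs. Both weights are recomputed from
  scratch for every element. Randomness is then confined to one toss per element, and all the rest
  is a deterministic program whose effect is a function of the store.\<close>

unbundle no inner_syntax
unbundle no vec_syntax

section \<open>Principal minors and elimination\<close>

text \<open>The Leibniz sum of a minor on the index set \<open>T\<close> itself. Without the
  renumbering done by \<open>submatrix\<close>, minors for varying \<open>T\<close> can be handled
  inside one sum.\<close>

definition perm_sum :: "nat set \<Rightarrow> (nat \<Rightarrow> nat \<Rightarrow> 'a::comm_ring_1) \<Rightarrow> 'a" where
  "perm_sum T A = (\<Sum>p | p permutes T. signof p * (\<Prod>i\<in>T. A i (p i)))"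

text \<open>An identity block outside \<open>T\<close> turns the minor into a determinant of the
  fixed size \<open>n\<close>, to which \<open>det_nonneg_of_psd\<close> applies.\<close>

definition pad :: "nat \<Rightarrow> nat set \<Rightarrow> 'a::comm_ring_1 mat \<Rightarrow> 'a mat" where
  "pad n T A = mat n n (\<lambda>(i,j). if i \<in> T \<and> j \<in> T then A $$ (i,j) else if i = j then 1 else 0)"

text \<open>A permutation that moves a point outside \<open>T\<close> picks up a factor 0 there;
  those that fix all such points are precisely the permutations of \<open>T\<close>.\<close>

lemma sum_permutes_fixing:
  fixes A :: "nat \<Rightarrow> nat \<Rightarrow> 'a::comm_ring_1"
  assumes "T \<subseteq> {0..<n}"
  shows "(\<Sum>p | p permutes {0..<n}. signof p *
            ((\<Prod>i\<in>T. A i (p i)) * (\<Prod>i\<in>{0..<n} - T. if i = p i then 1 else 0))) = perm_sum T A"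
  unfolding perm_sum_def
proof (rule sum.mono_neutral_cong_right)
  show "finite {p. p permutes {0..<n}}" by (simp add: finite_permutations)
  show "{p. p permutes T} \<subseteq> {p. p permutes {0..<n}}"
    using assms by (auto intro: permutes_subset)
  show "\<forall>p\<in>{p. p permutes {0..<n}} - {p. p permutes T}. signof p *
      ((\<Prod>i\<in>T. A i (p i)) * (\<Prod>i\<in>{0..<n} - T. if i = p i then 1 else 0)) = 0"
  proof
    fix p assume p: "p \<in> {p. p permutes {0..<n}} - {p. p permutes T}"
    then obtain i where "i \<in> {0..<n} - T" "p i \<noteq> i"
      using permutes_superset[of p "{0..<n}" T] by auto
    then have "(\<Prod>i\<in>{0..<n} - T. if i = p i then 1 else (0::'a)) = 0"
      by (intro prod_zero) (auto intro!: bexI[of _ i])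
    then show "signof p * ((\<Prod>i\<in>T. A i (p i)) * (\<Prod>i\<in>{0..<n} - T. if i = p i then 1 else 0)) = 0"
      by simp
  qed
  fix p assume "p \<in> {p. p permutes T}"
  then have "(\<Prod>i\<in>{0..<n} - T. if i = p i then 1 else (0::'a)) = 1"
    by (intro prod.neutral) (auto simp: permutes_not_in)
  then show "signof p * ((\<Prod>i\<in>T. A i (p i)) * (\<Prod>i\<in>{0..<n} - T. if i = p i then 1 else 0))
      = signof p * (\<Prod>i\<in>T. A i (p i))" by simp
qed

lemma det_pad:
  assumes "T \<subseteq> {0..<n}"
  shows "Determinant.det (pad n T A) = perm_sum T (\<lambda>i j. A $$ (i,j))"
proof -
  have c: "pad n T A \<in> carrier_mat n n" by (simp add: pad_def)
  have 1: "(\<Prod>i=0..<n. pad n T A $$ (i, p i)) =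
      (\<Prod>i\<in>T. if p i \<in> T then A $$ (i, p i) else 0) * (\<Prod>i\<in>{0..<n} - T. if i = p i then 1 else 0)"
    if p: "p permutes {0..<n}" for p
  proof -
    have "(\<Prod>i=0..<n. pad n T A $$ (i, p i)) =
       (\<Prod>i\<in>{0..<n} - T. pad n T A $$ (i, p i)) * (\<Prod>i\<in>T. pad n T A $$ (i, p i))"
      using assms by (intro prod.subset_diff) auto
    moreover have "(\<Prod>i\<in>{0..<n} - T. pad n T A $$ (i, p i)) = (\<Prod>i\<in>{0..<n} - T. if i = p i then 1 else 0)"
      using permutes_in_image[OF p] by (intro prod.cong) (auto simp: pad_def)
    moreover have "(\<Prod>i\<in>T. pad n T A $$ (i, p i)) = (\<Prod>i\<in>T. if p i \<in> T then A $$ (i, p i) else 0)"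
      using permutes_in_image[OF p] assms by (intro prod.cong) (auto simp: pad_def subset_iff)
    ultimately show ?thesis by (simp add: mult.commute)
  qed
  have "Determinant.det (pad n T A) = (\<Sum>p | p permutes {0..<n}. signof p *
      ((\<Prod>i\<in>T. if p i \<in> T then A $$ (i, p i) else 0) * (\<Prod>i\<in>{0..<n} - T. if i = p i then 1 else 0)))"
    unfolding det_def'[OF c] by (intro sum.cong refl) (simp add: 1)
  also have "\<dots> = perm_sum T (\<lambda>i j. if j \<in> T then A $$ (i, j) else 0)"
    using sum_permutes_fixing[OF assms, of "\<lambda>i j. if j \<in> T then A $$ (i, j) else 0"] by simp
  \<comment> \<open>A permutation of \<open>T\<close> never leaves \<open>T\<close>, so cutting the
    columns down to \<open>T\<close> no longer has any effect.\<close>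
  also have "\<dots> = perm_sum T (\<lambda>i j. A $$ (i,j))"
    unfolding perm_sum_def by (intro sum.cong refl arg_cong2[where f="(*)"] prod.cong)
      (auto dest: permutes_in_image)
  finally show ?thesis .
qed

text \<open>Multiply out the Leibniz products, with \<open>T\<close> as the set of rows in which the
  term with \<open>d i\<close> is chosen. The remaining rows force the permutation to fix them,
  which leaves the minor on \<open>T\<close>.\<close>

lemma det_one_plus_diag_mult:
  fixes d :: "nat \<Rightarrow> 'a::comm_ring_1"
  shows "Determinant.det (mat n n (\<lambda>(i,j). (if i = j then 1 else 0) + d i * A i j))
    = (\<Sum>T\<in>Pow {0..<n}. (\<Prod>i\<in>T. d i) * perm_sum T A)" (is "Determinant.det ?M = _")
proof -
  have c: "?M \<in> carrier_mat n n" by simp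
  have "Determinant.det ?M = (\<Sum>p | p permutes {0..<n}. signof p *
      (\<Prod>i=0..<n. d i * A i (p i) + (if i = p i then 1 else 0)))"
    unfolding det_def'[OF c]
    by (intro sum.cong refl arg_cong2[where f="(*)"] prod.cong)
       (auto dest: permutes_in_image simp: add.commute)
  also have "\<dots> = (\<Sum>p | p permutes {0..<n}. \<Sum>T\<in>Pow {0..<n}. (\<Prod>i\<in>T. d i) * (signof p *
      ((\<Prod>i\<in>T. A i (p i)) * (\<Prod>i\<in>{0..<n} - T. if i = p i then 1 else 0))))"
    by (simp add: prod_add prod.distrib sum_distrib_left mult_ac)
  also have "\<dots> = (\<Sum>T\<in>Pow {0..<n}. (\<Prod>i\<in>T. d i) * (\<Sum>p | p permutes {0..<n}. signof p *
      ((\<Prod>i\<in>T. A i (p i)) * (\<Prod>i\<in>{0..<n} - T. if i = p i then 1 else 0))))"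
    by (subst sum.swap) (simp add: sum_distrib_left)
  also have "\<dots> = (\<Sum>T\<in>Pow {0..<n}. (\<Prod>i\<in>T. d i) * perm_sum T A)"
    by (intro sum.cong refl) (simp add: sum_permutes_fixing)
  finally show ?thesis .
qed

lemma det_eq_perm_sum: "Determinant.det (mat n n (\<lambda>(i,j). A i j)) = perm_sum {0..<n} A"
  by (subst det_def'[of _ n]) (auto simp: perm_sum_def dest: permutes_in_image
    intro!: sum.cong arg_cong2[where f="(*)"] prod.cong)

text \<open>Conjugation with \<open>f\<close> carries the permutations of \<open>B\<close>
  bijectively to those of \<open>T\<close> and preserves signs.\<close>

lemma perm_sum_reindex:
  fixes A :: "nat \<Rightarrow> nat \<Rightarrow> 'a::comm_ring_1"
  assumes f: "bij_betw f B T" and fin: "finite B"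
  shows "perm_sum T A = perm_sum B (\<lambda>i j. A (f i) (f j))"
proof -
  have inj: "inj_on f B" using f by (simp add: bij_betw_def)
  have bij: "bij_betw (map_permutation B f) {p. p permutes B} {p. p permutes T}"
    unfolding bij_betw_def
  proof
    have "map_permutation T (inv_into B f) (map_permutation B f p) = p" if "p permutes B" for p
      using map_permutation_compose_inv[OF f that] inj by (simp add: bij_betw_inv_into_left[OF f])
    then show "inj_on (map_permutation B f) {p. p permutes B}"
      by (metis (mono_tags, lifting) inj_onI mem_Collect_eq)
    have "map_permutation B f (map_permutation T (inv_into B f) p) = p" if "p permutes T" for p
      using map_permutation_compose_inv[OF bij_betw_inv_into[OF f] that]
      by (simp add: bij_betw_inv_into_right[OF f])
    then show "map_permutation B f ` {p. p permutes B} = {p. p permutes T}"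
      using map_permutation_permutes[OF f] map_permutation_permutes[OF bij_betw_inv_into[OF f]]
      by (auto simp: image_iff) metis
  qed
  have "perm_sum T A = (\<Sum>p | p permutes B. signof (map_permutation B f p) *
      (\<Prod>i\<in>T. A i (map_permutation B f p i)))"
    unfolding perm_sum_def
    by (rule sum.reindex_bij_betw[OF bij, symmetric])
  also have "\<dots> = perm_sum B (\<lambda>i j. A (f i) (f j))"
    unfolding perm_sum_def
  proof (intro sum.cong refl arg_cong2[where f="(*)"])
    fix p assume "p \<in> {p. p permutes B}"
    then have p: "p permutes B" by simp
    show "signof (map_permutation B f p) = (signof p :: 'a)"
      using sign_map_permutation[OF inj p fin] by simp
    have "(\<Prod>i\<in>T. A i (map_permutation B f p i)) = (\<Prod>i\<in>B. A (f i) (map_permutation B f p (f i)))"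
      by (rule prod.reindex_bij_betw[OF f, symmetric])
    also have "\<dots> = (\<Prod>i\<in>B. A (f i) (f (p i)))"
      by (intro prod.cong refl) (simp add: map_permutation_apply[OF inj])
    finally show "(\<Prod>i\<in>T. A i (map_permutation B f p i)) = (\<Prod>i\<in>B. A (f i) (f (p i)))" .
  qed
  finally show ?thesis .
qed

lemma bij_betw_pick:
  assumes "finite T"
  shows "bij_betw (pick T) {0..<card T} T"
proof -
  have "inj_on (pick T) {0..<card T}"
  proof (rule inj_onI)
    fix a b assume "a \<in> {0..<card T}" "b \<in> {0..<card T}" and eq: "pick T a = pick T b"
    then have "a < card T" "b < card T" by simp_all
    from this[THEN card_pick_le] show "a = b" unfolding eq by (rule trans[OF sym])
  qed
  moreover have "pick T ` {0..<card T} \<subseteq> T" by (auto intro: pick_in_set_le)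
  ultimately show ?thesis
    using assms by (simp add: bij_betw_def card_image card_subset_eq)
qed

lemma principal_minor_eq_perm_sum:
  assumes L: "L \<in> carrier_mat n n" and T: "T \<subseteq> {0..<n}"
  shows "principal_minor L T = perm_sum T (\<lambda>i j. L $$ (i,j))"
proof -
  have fin: "finite T" using T finite_subset by blast
  have "{i. i < n \<and> i \<in> T} = T" using T by auto
  then have "submatrix L T T = mat (card T) (card T) (\<lambda>(i,j). L $$ (pick T i, pick T j))"
    using L by (simp add: submatrix_def)
  then show ?thesis
    by (simp add: principal_minor_def det_eq_perm_sum perm_sum_reindex[OF bij_betw_pick[OF fin]])
qed

text \<open>For \<open>B = - A\<close> the characteristic polynomial at 0 is the determinant of
  \<open>A\<close>, without a sign. It is monic and has no positive root, because an eigenvector for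
  \<open>x > 0\<close> would make the quadratic form of \<open>A\<close> negative. A negative value
  at 0 would contradict the intermediate value theorem.\<close>

lemma det_nonneg_of_psd:
  fixes A :: "real mat"
  assumes A: "A \<in> carrier_mat n n"
    and psd: "\<And>x. x \<in> carrier_vec n \<Longrightarrow> 0 \<le> x \<bullet> (A *\<^sub>v x)"
  shows "0 \<le> Determinant.det A"
proof -
  define B where "B = - A"
  have B: "B \<in> carrier_mat n n" using A by (simp add: B_def)
  have noroot: "poly (char_poly B) x \<noteq> 0" if "0 < x" for x
  proof
    assume "poly (char_poly B) x = 0"
    then have "eigenvalue B x" using eigenvalue_root_char_poly[OF B] by simp
    then obtain v where v: "v \<in> carrier_vec n" "v \<noteq> 0\<^sub>v n" "B *\<^sub>v v = x \<cdot>\<^sub>v v"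
      using B by (auto simp: eigenvalue_def eigenvector_def)
    have "A *\<^sub>v v = - (B *\<^sub>v v)" using A v(1) unfolding B_def by (auto intro!: eq_vecI)
    then have "v \<bullet> (A *\<^sub>v v) = - (x * (v \<bullet> v))" using v by simp
    moreover have "v \<bullet> v > 0"
    proof -
      obtain i where i: "i < n" "v $ i \<noteq> 0"
        using v(1,2) by (metis carrier_vecD eq_vecI index_zero_vec)
      have "0 < (\<Sum>i = 0..<n. v $ i * v $ i)"
        using i by (intro sum_pos2[of _ i]) (auto simp: zero_less_mult_iff)
      then show ?thesis using v(1) by (simp add: scalar_prod_def)
    qed
    ultimately show False using psd[OF v(1)] that mult_pos_pos[of x "v \<bullet> v"] by linarith
  qed
  have deg: "degree (char_poly B) = n" "lead_coeff (char_poly B) = 1"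
    using degree_monic_char_poly[OF B] by auto
  have "0 \<le> poly (char_poly B) 0"
  proof (rule ccontr)
    assume neg: "\<not> 0 \<le> poly (char_poly B) 0"
    obtain N where "\<And>x. x \<ge> N \<Longrightarrow> poly (char_poly B) x \<ge> lead_coeff (char_poly B)"
      using poly_pinfty_gt_lc[of "char_poly B"] deg by auto
    then have "poly (char_poly B) (max N 1) > 0" using deg(2)
      by (smt (verit) max.cobounded1)
    then show False
      using poly_IVT_pos[of 0 "max N 1" "char_poly B"] neg noroot by force
  qed
  moreover have "poly (char_poly B) 0 = Determinant.det A"
  proof -
    have "poly (char_poly B) 0 = Determinant.det (- char_matrix B 0)"
      by (rule char_poly_matrix[OF B])
    also have "- char_matrix B 0 = A"
      using A by (auto simp: char_matrix_def B_def)
    finally show ?thesis .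
  qed
  ultimately show ?thesis by simp
qed

text \<open>The quadratic form splits: the coordinates in \<open>T\<close> give the form of
  \<open>L\<close> at their restriction \<open>y\<close>, and the identity block gives a sum of
  squares.\<close>

lemma pad_psd:
  assumes L: "L \<in> carrier_mat n n" and psd: "positive_semidefinite L" and T: "T \<subseteq> {0..<n}"
    and x: "x \<in> carrier_vec n"
  shows "0 \<le> x \<bullet> (pad n T L *\<^sub>v x)"
proof -
  define y where "y = vec n (\<lambda>i. if i \<in> T then x $ i else 0)"
  have row: "(pad n T L *\<^sub>v x) $ i = (if i \<in> T then (L *\<^sub>v y) $ i else x $ i)" if i: "i < n" for i
  proof (cases "i \<in> T")
    case True
    have "(pad n T L *\<^sub>v x) $ i = (\<Sum>j = 0..<n. (if j \<in> T then L $$ (i,j) else if i = j then 1 else 0) * x $ j)"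
      using i x True by (simp add: pad_def scalar_prod_def)
    also have "\<dots> = (\<Sum>j = 0..<n. L $$ (i,j) * y $ j)"
      using True by (intro sum.cong) (auto simp: y_def)
    also have "\<dots> = (L *\<^sub>v y) $ i" using i L by (simp add: scalar_prod_def y_def)
    finally show ?thesis using True by simp
  next
    case False
    have "(pad n T L *\<^sub>v x) $ i = (\<Sum>j = 0..<n. (if i = j then 1 else 0) * x $ j)"
      using i x False by (simp add: pad_def scalar_prod_def)
    also have "\<dots> = (\<Sum>j = 0..<n. if j = i then x $ j else 0)" by (intro sum.cong) auto
    also have "\<dots> = x $ i" using i by simp
    finally show ?thesis using False by simp
  qed
  have "x \<bullet> (pad n T L *\<^sub>v x) = (\<Sum>i = 0..<n. x $ i * (if i \<in> T then (L *\<^sub>v y) $ i else x $ i))"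
    using x row by (simp add: scalar_prod_def pad_def)
  also have "\<dots> = (\<Sum>i = 0..<n. y $ i * (L *\<^sub>v y) $ i + (if i \<in> T then 0 else (x $ i)\<^sup>2))"
    by (intro sum.cong) (auto simp: y_def power2_eq_square)
  also have "\<dots> = y \<bullet> (L *\<^sub>v y) + (\<Sum>i = 0..<n. if i \<in> T then 0 else (x $ i)\<^sup>2)"
    using L by (simp add: sum.distrib scalar_prod_def)
  finally show ?thesis
    using psd L unfolding positive_semidefinite_def
    by (auto simp: y_def intro!: add_nonneg_nonneg sum_nonneg)
qed

lemma principal_minor_nonneg:
  assumes L: "L \<in> carrier_mat n n" and psd: "positive_semidefinite L" and T: "T \<subseteq> {0..<n}"
  shows "0 \<le> principal_minor L T"
proof -
  have "0 \<le> Determinant.det (pad n T L)"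
    by (rule det_nonneg_of_psd[of _ n]) (use pad_psd[OF assms] in \<open>auto simp: pad_def\<close>)
  then show ?thesis by (simp add: det_pad[OF T] principal_minor_eq_perm_sum[OF L T])
qed

text \<open>
  The recurrence is Gaussian elimination that subtracts row \<open>k\<close> from every row, including those
  up to \<open>k\<close> itself, which it turns into 0.  Summing its steps gives the factorization of \<open>E 0\<close>
  into triangular matrices.
\<close>

lemma det_elimination:
  fixes E :: "nat \<Rightarrow> nat \<Rightarrow> nat \<Rightarrow> 'a::comm_ring_1"
  assumes rec: "\<And>k i j. k < n \<Longrightarrow> E (Suc k) i j = E k i j - E k i k * R k * E k k j"
    and inv: "\<And>k. k < n \<Longrightarrow> E k k k * R k = 1"
  shows "Determinant.det (mat n n (\<lambda>(i,j). E 0 i j)) = (\<Prod>k<n. E k k k)"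
proof -
  have zero: "E k i j = 0" if "k \<le> n" "i < k \<or> j < k" for k i j
    using that
  proof (induction k arbitrary: i j)
    case (Suc k)
    then have k: "k < n" by simp
    have inv': "R k * E k k k = 1" using inv[OF k] by (simp add: mult.commute)
    show ?case
    proof (cases "i < k \<or> j < k")
      case True
      then have "E k i j = 0" "E k i k = 0 \<or> E k k j = 0"
        using Suc.IH[of i j] Suc.IH[of i k] Suc.IH[of k j] k by auto
      then show ?thesis by (auto simp: rec[OF k])
    next
      case False
      then consider "i = k" | "j = k" using Suc.prems by force
      then show ?thesis by cases (simp_all add: rec[OF k] inv[OF k] inv' mult.assoc[of _ "R k"])
    qed
  qed simp
  have tele: "E k i j = E 0 i j - (\<Sum>l<k. E l i l * R l * E l l j)" if "k \<le> n" for k i j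
    using that by (induction k) (auto simp: rec)
  \<comment> \<open>Scaling column \<open>k\<close> by \<open>R k\<close> puts ones on the diagonal
    of \<open>Lo\<close>, so that the pivots appear only on the diagonal of
    \<open>U\<close>.\<close>
  define Lo where "Lo = mat n n (\<lambda>(i,k). E k i k * R k)"
  define U where "U = mat n n (\<lambda>(k,j). E k k j)"
  have c: "Lo \<in> carrier_mat n n" "U \<in> carrier_mat n n" by (auto simp: Lo_def U_def)
  have "mat n n (\<lambda>(i,j). E 0 i j) = Lo * U"
  proof (rule eq_matI)
    fix i j assume "i < dim_row (Lo * U)" "j < dim_col (Lo * U)"
    then have ij: "i < n" "j < n" by (auto simp: Lo_def U_def)
    \<comment> \<open>The remainder \<open>E n i j\<close> is 0, because all rows have been cleared
      by then.\<close>
    have "E 0 i j = (\<Sum>l<n. E l i l * R l * E l l j)"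
      using tele[of n i j] zero[of n i j] ij by simp
    then show "mat n n (\<lambda>(i,j). E 0 i j) $$ (i,j) = (Lo * U) $$ (i,j)"
      using ij by (simp add: Lo_def U_def scalar_prod_def atLeast0LessThan)
  qed (auto simp: Lo_def U_def)
  moreover have "Determinant.det Lo = 1"
  proof -
    have "Lo $$ (i, j) = 0" if "i < j" "j < n" for i j
      using that zero[of j i j] by (simp add: Lo_def)
    then have "Determinant.det Lo = prod_list (diag_mat Lo)" by (rule det_lower_triangular[OF _ c(1)])
    also have "\<dots> = 1" by (simp add: prod_list_diag_prod Lo_def inv)
    finally show ?thesis .
  qed
  moreover have "Determinant.det U = (\<Prod>k<n. E k k k)"
  proof -
    have "upper_triangular U" using zero by (auto simp: U_def)
    then have "Determinant.det U = prod_list (diag_mat U)" by (rule det_upper_triangular[OF _ c(2)])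
    also have "\<dots> = (\<Prod>k<n. E k k k)"
      by (simp add: prod_list_diag_prod U_def atLeast0LessThan)
    finally show ?thesis .
  qed
  ultimately show ?thesis using det_mult[OF c] by simp
qed

section \<open>Weights of partial choices as coefficients\<close>

lemma perm_sum_fps_const: "perm_sum T (\<lambda>i j. fps_const (A i j)) = fps_const (perm_sum T A)"
proof -
  have p: "(\<Prod>i\<in>S. fps_const (f i)) = fps_const (\<Prod>i\<in>S. f i)" for S and f :: "nat \<Rightarrow> 'a"
    by (induction S rule: infinite_finite_induct) auto
  have s: "(\<Sum>i\<in>S. fps_const (f i)) = fps_const (\<Sum>i\<in>S. f i)" for S and f :: "(nat \<Rightarrow> nat) \<Rightarrow> 'a"
    by (induction S rule: infinite_finite_induct) auto
  show ?thesis by (simp add: perm_sum_def p s fps_of_int[symmetric])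
qed

fun elim :: "(nat \<Rightarrow> nat \<Rightarrow> real fps) \<Rightarrow> nat \<Rightarrow> nat \<Rightarrow> nat \<Rightarrow> real fps" where
  "elim M 0 i j = M i j"
| "elim M (Suc k) i j = elim M k i j - elim M k i k * inverse (elim M k k k) * elim M k k j"

text \<open>The subtracted term has the factor \<open>elim M k i k\<close> with
  \<open>k < i\<close>, whose constant term is 0. So a step preserves the constant terms in the rows
  and columns still to be processed, and the next pivot is invertible.\<close>

lemma elim_const_coeff:
  assumes M: "\<And>i j. i < n \<Longrightarrow> j < n \<Longrightarrow> fps_nth (M i j) 0 = (if i = j then 1 else 0)"
    and "k \<le> i" "k \<le> j" "i < n" "j < n"
  shows "fps_nth (elim M k i j) 0 = (if i = j then 1 else 0)"
  using assms(2-) by (induction k arbitrary: i j) (simp_all add: M)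

lemma det_elim:
  assumes M: "\<And>i j. i < n \<Longrightarrow> j < n \<Longrightarrow> fps_nth (M i j) 0 = (if i = j then 1 else 0)"
  shows "Determinant.det (mat n n (\<lambda>(i,j). M i j)) = (\<Prod>k<n. elim M k k k)"
proof -
  have "elim M k k k * inverse (elim M k k k) = 1" if "k < n" for k
    using elim_const_coeff[of n M k k k, OF M] that by (simp add: inverse_mult_eq_1')
  then show ?thesis
    using det_elimination[of n "elim M" "\<lambda>k. inverse (elim M k k k)"] by simp
qed

text \<open>Compare coefficients in \<open>inverse f * f = 1\<close>. Each coefficient depends on
  earlier ones only, so a loop can compute them in order.\<close>

lemma fps_inverse_nth_rec:
  fixes f :: "real fps"
  assumes "fps_nth f 0 = 1"
  shows "fps_nth (inverse f) w
    = (if w = 0 then 1 else - (\<Sum>u<w. fps_nth f (w - u) * fps_nth (inverse f) u))"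
proof (cases w)
  case (Suc v)
  have "fps_nth (inverse f * f) w = 0"
    using assms Suc by (simp add: inverse_mult_eq_1)
  then have "(\<Sum>u\<le>w. fps_nth (inverse f) u * fps_nth f (w - u)) = 0"
    by (simp only: fps_mult_nth atLeast0AtMost)
  then have "(\<Sum>u<w. fps_nth (inverse f) u * fps_nth f (w - u)) + fps_nth (inverse f) w = 0"
    using assms by (simp add: lessThan_Suc_atMost[symmetric])
  then show ?thesis using Suc by (simp add: mult.commute)
qed (use assms in simp)

text \<open>The sum has a guard instead of the upper limit \<open>w\<close> because the loops of the
  program run up to the fixed bound \<open>N\<close>.\<close>

lemma fps_mult_nth_lessThan:
  assumes "w < N"
  shows "fps_nth (f * g) w = (\<Sum>u<N. if u \<le> w then fps_nth f u * fps_nth g (w - u) else 0)"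
proof -
  have "{u. u < N \<and> u \<le> w} = {0..w}" using assms by auto
  then show ?thesis by (simp add: fps_mult_nth sum.If_cases Int_def)
qed

section \<open>Exponents that encode cost and counts\<close>

lemma norm1_eq: "int (norm1 c) = (\<Sum>i<dim_vec c. \<bar>vec_index c i\<bar>)"
  by (simp add: norm1_def sum_nonneg)

lemma abs_set_cost_le:
  assumes "T \<subseteq> {..<dim_vec c}"
  shows "\<bar>set_cost c T\<bar> \<le> int (norm1 c)"
proof -
  have "\<bar>set_cost c T\<bar> \<le> (\<Sum>i\<in>T. \<bar>vec_index c i\<bar>)" unfolding set_cost_def by (rule sum_abs)
  also have "\<dots> \<le> int (norm1 c)" unfolding norm1_eq using assms by (intro sum_mono2) auto
  finally show ?thesis .
qed

lemma abs_cost_le: "i < dim_vec c \<Longrightarrow> \<bar>vec_index c i\<bar> \<le> int (norm1 c)"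
  using abs_set_cost_le[of "{i}" c] by (simp add: set_cost_def)

definition radix :: "int vec \<Rightarrow> int" where
  "radix c = 2 * int (norm1 c) + 1"

text \<open>The number of coefficients to keep, as it exceeds every exponent that occurs
  (\<open>sum_exponent_less\<close>). The running time is polynomial because this number is.\<close>

definition degree_bound :: "int vec \<Rightarrow> nat" where
  "degree_bound c = (2 * norm1 c + 1) * ((dim_vec c + 1) * (dim_vec c + 1))"

text \<open>The elements below \<open>i\<close> are the decided ones. Each counts as
  \<open>dim_vec c + 1\<close>, one unit of the next digit, since there are at most
  \<open>dim_vec c\<close> undecided ones.\<close>

definition exponent :: "int vec \<Rightarrow> nat \<Rightarrow> nat \<Rightarrow> int" where
  "exponent c i j = vec_index c j + radix c * (if i \<le> j then 1 else int (dim_vec c) + 1)"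

definition marked_diag :: "int vec \<Rightarrow> nat set \<Rightarrow> nat \<Rightarrow> nat \<Rightarrow> real fps" where
  "marked_diag c A i j = (if i \<le> j \<or> j \<in> A then fps_X ^ nat (exponent c i j) else 0)"

definition marked_entry :: "real mat \<Rightarrow> int vec \<Rightarrow> nat set \<Rightarrow> nat \<Rightarrow> nat \<Rightarrow> nat \<Rightarrow> real fps" where
  "marked_entry L c A i j l =
     (if j = l then 1 else 0) + marked_diag c A i j * fps_const (L $$ (j,l))"

text \<open>Defined by the pivots because their product is what the program computes;
  \<open>marked_det_eq\<close> identifies it with the expanded determinant.\<close>

definition marked_det :: "real mat \<Rightarrow> int vec \<Rightarrow> nat set \<Rightarrow> nat \<Rightarrow> real fps" where
  "marked_det L c A i = (\<Prod>k<dim_vec c. elim (marked_entry L c A i) k k k)"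

definition weight :: "real mat \<Rightarrow> int vec \<Rightarrow> int \<Rightarrow> nat set \<Rightarrow> nat \<Rightarrow> real" where
  "weight L c C A i = (\<Sum>T | T \<in> feasible_sets c C \<and> T \<inter> {..<i} = A. principal_minor L T)"

text \<open>One unit of the count digit outweighs any negative cost, since \<open>radix c\<close>
  exceeds \<open>norm1 c\<close>.\<close>

lemma exponent_pos: "j < dim_vec c \<Longrightarrow> 0 < exponent c i j"
proof -
  assume j: "j < dim_vec c"
  define f where "f = (if i \<le> j then 1 else int (dim_vec c) + 1)"
  have "radix c * 1 \<le> radix c * f"
    by (intro mult_left_mono) (auto simp: radix_def f_def)
  moreover have "int (norm1 c) < radix c" by (simp add: radix_def)
  ultimately show ?thesis using abs_cost_le[OF j] unfolding exponent_def f_def[symmetric] by linarith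
qed

lemma marked_entry_const_coeff:
  "j < dim_vec c \<Longrightarrow> fps_nth (marked_entry L c A i j l) 0 = (if j = l then 1 else 0)"
  using exponent_pos[of j c i] by (auto simp: marked_entry_def marked_diag_def)

text \<open>A positive exponent keeps the monomial away from the constant term, so every coefficient
  has a single source and can be selected by tests, as \<open>entry_body\<close> does.\<close>

lemma marked_entry_nth:
  assumes "j < dim_vec c"
  shows "fps_nth (marked_entry L c A i j l) w
    = (if (i \<le> j \<or> j \<in> A) \<and> int w = exponent c i j then L $$ (j,l)
       else if j = l \<and> w = 0 then 1 else 0)"
  using exponent_pos[OF assms, of i] by (auto simp: marked_entry_def marked_diag_def)

lemma sum_exponent:
  assumes "T \<subseteq> {..<dim_vec c}"
  shows "(\<Sum>j\<in>T. exponent c i j) = set_cost c T +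
    radix c * (int (card (T - {..<i})) + (int (dim_vec c) + 1) * int (card (T \<inter> {..<i})))"
proof -
  have fin: "finite T" using assms finite_subset by blast
  have sets: "T \<inter> {j. i \<le> j} = T - {..<i}" "T \<inter> - {j. i \<le> j} = T \<inter> {..<i}" by auto
  have "(\<Sum>j\<in>T. if i \<le> j then 1 else int (dim_vec c) + 1)
      = (\<Sum>j\<in>T - {..<i}. 1) + (\<Sum>j\<in>T \<inter> {..<i}. int (dim_vec c) + 1)"
    using fin by (simp add: sum.If_cases sets)
  then show ?thesis
    by (simp add: exponent_def sum.distrib sum_distrib_left[symmetric] set_cost_def mult.commute)
qed

text \<open>A set with a decided element outside \<open>A\<close> has a zero factor in the expansion
  of the determinant. Proper subsets of \<open>A\<close> as decided part survive here; they are
  sorted out later by their exponents.\<close>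

lemma marked_det_eq:
  assumes L: "L \<in> carrier_mat (dim_vec c) (dim_vec c)"
  shows "marked_det L c A i = (\<Sum>T | T \<subseteq> {..<dim_vec c} \<and> T \<inter> {..<i} \<subseteq> A.
    fps_X ^ nat (\<Sum>j\<in>T. exponent c i j) * fps_const (principal_minor L T))"
proof -
  let ?m = "dim_vec c"
  have prod: "(\<Prod>j\<in>T. marked_diag c A i j)
      = (if T \<inter> {..<i} \<subseteq> A then fps_X ^ nat (\<Sum>j\<in>T. exponent c i j) else 0)"
    if T: "T \<subseteq> {..<?m}" for T
  proof (cases "T \<inter> {..<i} \<subseteq> A")
    case True
    have nn: "0 \<le> exponent c i j" if "j \<in> T" for j
      using that T exponent_pos[of j c i] by auto
    have "(\<Prod>j\<in>T. marked_diag c A i j) = (\<Prod>j\<in>T. fps_X ^ nat (exponent c i j))"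
      using True by (intro prod.cong) (auto simp: marked_diag_def)
    also have "\<dots> = fps_X ^ (\<Sum>j\<in>T. nat (exponent c i j))" by (simp add: power_sum)
    also have "(\<Sum>j\<in>T. nat (exponent c i j)) = nat (\<Sum>j\<in>T. exponent c i j)"
      using nn by (simp flip: of_nat_eq_iff[where 'a=int] add: sum_nonneg)
    finally show ?thesis using True by simp
  next
    case False
    then obtain j where "j \<in> T" "j < i" "j \<notin> A" by auto
    then show ?thesis
      using False T finite_subset[of T "{..<?m}"]
      by (auto intro!: prod_zero bexI[of _ j] simp: marked_diag_def)
  qed
  have "marked_det L c A i = Determinant.det (mat ?m ?m (\<lambda>(j,l). marked_entry L c A i j l))"
    unfolding marked_det_def
    by (rule det_elim[symmetric]) (simp add: marked_entry_const_coeff)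
  also have "\<dots> = (\<Sum>T\<in>Pow {0..<?m}. (\<Prod>j\<in>T. marked_diag c A i j) *
      perm_sum T (\<lambda>j l. fps_const (L $$ (j,l))))"
    unfolding marked_entry_def by (rule det_one_plus_diag_mult)
  also have "\<dots> = (\<Sum>T\<in>Pow {..<?m}. if T \<inter> {..<i} \<subseteq> A
      then fps_X ^ nat (\<Sum>j\<in>T. exponent c i j) * fps_const (principal_minor L T) else 0)"
    by (intro sum.cong)
       (auto simp: atLeast0LessThan perm_sum_fps_const prod principal_minor_eq_perm_sum[OF L])
  also have "\<dots> = (\<Sum>T | T \<subseteq> {..<?m} \<and> T \<inter> {..<i} \<subseteq> A.
    fps_X ^ nat (\<Sum>j\<in>T. exponent c i j) * fps_const (principal_minor L T))"
    by (subst sum.inter_filter[symmetric]) (auto intro!: sum.cong)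
  finally show ?thesis .
qed

text \<open>
  Costs lie in \<open>[-norm1 c, norm1 c]\<close>, a range of \<open>radix c\<close> values.  So the exponent of a set
  determines its cost together with the number \<open>(m + 1) b + g\<close>, where \<open>b\<close> counts its decided and
  \<open>g \<le> m\<close> its undecided elements.  A set whose decided part lies in \<open>A\<close> extends \<open>A\<close> iff
  \<open>b = card A\<close>.
\<close>

lemma exponent_decode:
  assumes T: "T \<subseteq> {..<dim_vec c}" and sub: "T \<inter> {..<i} \<subseteq> A" and fin: "finite A"
    and g: "g \<le> dim_vec c"
  defines "x \<equiv> (\<Sum>j\<in>T. exponent c i j) - radix c * ((int (dim_vec c) + 1) * int (card A) + int g)"
  shows "(- int (norm1 c) \<le> x \<and> x \<le> int (norm1 c) \<and> x \<le> C) \<longleftrightarrow>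
    g = card (T - {..<i}) \<and> T \<inter> {..<i} = A \<and> set_cost c T \<le> C"
proof -
  let ?m = "dim_vec c" and ?b = "card (T \<inter> {..<i})" and ?h = "card (T - {..<i})"
  \<comment> \<open>The difference between the actual count number of \<open>T\<close> and the one
    that is tested for.\<close>
  define z where "z = int ?h - int g + (int ?m + 1) * (int ?b - int (card A))"
  have x: "x = set_cost c T + radix c * z"
    unfolding x_def sum_exponent[OF T] z_def by (simp add: algebra_simps)
  have h: "?h \<le> ?m" using card_mono[of "{..<?m}" "T - {..<i}"] T by auto
  have z0: "z = 0 \<longleftrightarrow> g = ?h \<and> T \<inter> {..<i} = A"
  proof
    assume z: "z = 0"
    have "?b \<le> card A" using sub fin by (rule card_mono[rotated])
    \<comment> \<open>A missing element of \<open>A\<close> lowers \<open>z\<close> by at least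
      \<open>m + 1\<close>, which at most \<open>m\<close> undecided elements cannot make up
      for.\<close>
    moreover have "\<not> ?b < card A"
    proof
      assume "?b < card A"
      then have "(int ?m + 1) * (int ?b - int (card A)) \<le> (int ?m + 1) * (- 1)"
        by (intro mult_left_mono) auto
      then show False using z h unfolding z_def by simp
    qed
    ultimately have b: "?b = card A" by simp
    then show "g = ?h \<and> T \<inter> {..<i} = A" using z card_subset_eq[OF fin sub] by (simp add: z_def)
  qed (auto simp: z_def)
  have cost: "\<bar>set_cost c T\<bar> \<le> int (norm1 c)" by (rule abs_set_cost_le[OF T])
  \<comment> \<open>Both \<open>x\<close> and the cost lie within \<open>norm1 c\<close> of 0, so
    they differ by less than \<open>radix c\<close>, while their difference is the multiple
    \<open>radix c * z\<close>.\<close>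
  have "z = 0" if "\<bar>x\<bar> \<le> int (norm1 c)"
  proof (rule ccontr)
    assume "z \<noteq> 0"
    then have "radix c * 1 \<le> radix c * \<bar>z\<bar>" by (intro mult_left_mono) (auto simp: radix_def)
    then have "radix c \<le> \<bar>radix c * z\<bar>" by (simp add: abs_mult radix_def)
    then show False using that cost x by (simp add: radix_def)
  qed
  then have small: "z = 0" if "- int (norm1 c) \<le> x \<and> x \<le> int (norm1 c)" using that by linarith
  show ?thesis
  proof (cases "z = 0")
    case True
    then show ?thesis using z0 x cost by (simp add: abs_le_iff)
  next
    case False
    then show ?thesis using z0 small by blast
  qed
qed

text \<open>The count number is at most \<open>(m + 1) * m\<close>, and the cost stays below one
  further \<open>radix c\<close>.\<close>

lemma sum_exponent_less:
  assumes T: "T \<subseteq> {..<dim_vec c}"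
  shows "nat (\<Sum>j\<in>T. exponent c i j) < degree_bound c"
proof -
  let ?m = "dim_vec c" and ?b = "card (T \<inter> {..<i})" and ?h = "card (T - {..<i})"
  have fin: "finite T" using T finite_subset by blast
  have "?h + ?b = card T" using card_Diff_subset_Int[of T "{..<i}"] fin
    by (metis Int_Diff_disjoint Int_Diff_Un add.commute card_Un_disjoint finite_Diff finite_Int)
  also have "card T \<le> ?m" using card_mono[of "{..<?m}" T] T by simp
  finally have hb: "?h + ?b \<le> ?m" .
  have "?h + (?m + 1) * ?b \<le> (?m + 1) * (?h + ?b)" by simp
  also have "\<dots> \<le> (?m + 1) * ?m" using hb by (intro mult_left_mono) auto
  finally have "int (?h + (?m + 1) * ?b) \<le> int ((?m + 1) * ?m)" by (simp only: of_nat_le_iff)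
  then have "radix c * int (?h + (?m + 1) * ?b) \<le> radix c * int ((?m + 1) * ?m)"
    by (intro mult_left_mono) (auto simp: radix_def)
  moreover have "set_cost c T < radix c * 1"
    using abs_set_cost_le[OF T] by (simp add: radix_def)
  ultimately have "(\<Sum>j\<in>T. exponent c i j) < radix c * (1 + int ((?m + 1) * ?m))"
    unfolding sum_exponent[OF T] by (simp add: algebra_simps)
  also have "\<dots> \<le> radix c * int ((?m + 1) * (?m + 1))"
    by (intro mult_left_mono) (auto simp: radix_def algebra_simps)
  also have "\<dots> = int (degree_bound c)" by (simp add: degree_bound_def radix_def algebra_simps)
  finally have "(\<Sum>j\<in>T. exponent c i j) < int (degree_bound c)" .
  moreover have "0 < degree_bound c" by (simp add: degree_bound_def)
  ultimately show ?thesis by arith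
qed

text \<open>The number \<open>g\<close> of undecided elements of an extension is not known, hence
  the outer sum. By \<open>exponent_decode\<close> each extension of \<open>A\<close> with
  admissible cost is met by exactly one pair \<open>(g, w)\<close>, and every other set by none. The
  right-hand side has the form in which the program computes it.\<close>

lemma weight_eq_coeff_sum:
  assumes L: "L \<in> carrier_mat (dim_vec c) (dim_vec c)" and A: "finite A"
  shows "weight L c C A i = (\<Sum>g<dim_vec c + 1. \<Sum>w<degree_bound c.
    let x = int w - radix c * ((int (dim_vec c) + 1) * int (card A) + int g) in
    if - int (norm1 c) \<le> x \<and> x \<le> int (norm1 c) \<and> x \<le> C then fps_nth (marked_det L c A i) w else 0)"
    (is "_ = (\<Sum>g<_. \<Sum>w<_. ?t g w)")
proof -
  let ?m = "dim_vec c" and ?N = "degree_bound c"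
  define cond where "cond g w \<longleftrightarrow>
    (let x = int w - radix c * ((int ?m + 1) * int (card A) + int g) in
     - int (norm1 c) \<le> x \<and> x \<le> int (norm1 c) \<and> x \<le> C)" for g w
  define \<T> where "\<T> = {T. T \<subseteq> {..<?m} \<and> T \<inter> {..<i} \<subseteq> A}"
  define e where "e T = nat (\<Sum>j\<in>T. exponent c i j)" for T
  have fin: "finite \<T>" unfolding \<T>_def by (rule finite_subset[of _ "Pow {..<?m}"]) auto
  have coeff: "fps_nth (marked_det L c A i) w = (\<Sum>T\<in>\<T>. if w = e T then principal_minor L T else 0)" for w
    by (auto simp: marked_det_eq[OF L] fps_sum_nth fps_X_power_mult_nth \<T>_def e_def intro!: sum.cong)
  have e: "int (e T) = (\<Sum>j\<in>T. exponent c i j)" if "T \<in> \<T>" for T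
  proof -
    have "0 \<le> exponent c i j" if "j \<in> T" for j
      using exponent_pos[of j c i] that \<open>T \<in> \<T>\<close> by (auto simp: \<T>_def)
    then show ?thesis by (simp add: e_def sum_nonneg)
  qed
  have "(\<Sum>g<?m + 1. \<Sum>w<?N. ?t g w)
      = (\<Sum>g<?m + 1. \<Sum>w<?N. \<Sum>T\<in>\<T>. if cond g w \<and> w = e T then principal_minor L T else 0)"
  proof (intro sum.cong refl)
    fix g w
    have "?t g w = (if cond g w then fps_nth (marked_det L c A i) w else 0)"
      by (simp add: cond_def Let_def)
    also have "\<dots> = (\<Sum>T\<in>\<T>. if cond g w \<and> w = e T then principal_minor L T else 0)"
      by (cases "cond g w") (simp_all add: coeff)
    finally show "?t g w = (\<Sum>T\<in>\<T>. if cond g w \<and> w = e T then principal_minor L T else 0)" .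
  qed
  also have "\<dots> = (\<Sum>g<?m + 1. \<Sum>T\<in>\<T>. \<Sum>w<?N. if cond g w \<and> w = e T then principal_minor L T else 0)"
    by (intro sum.cong refl sum.swap)
  also have "\<dots> = (\<Sum>g<?m + 1. \<Sum>T\<in>\<T>. if cond g (e T) then principal_minor L T else 0)"
  proof (intro sum.cong refl)
    fix g T assume "T \<in> \<T>"
    \<comment> \<open>No set is lost by keeping only the coefficients below
      \<open>degree_bound c\<close>.\<close>
    then have "e T < ?N" using sum_exponent_less[of T c i] by (simp add: e_def \<T>_def)
    have "(\<Sum>w<?N. if cond g w \<and> w = e T then principal_minor L T else 0)
      = (\<Sum>w<?N. if w = e T then (if cond g (e T) then principal_minor L T else 0) else 0)"
      by (intro sum.cong) auto
    then show "(\<Sum>w<?N. if cond g w \<and> w = e T then principal_minor L T else 0)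
        = (if cond g (e T) then principal_minor L T else 0)" using \<open>e T < ?N\<close> by simp
  qed
  also have "\<dots> = (\<Sum>T\<in>\<T>. \<Sum>g<?m + 1. if cond g (e T) then principal_minor L T else 0)"
    by (rule sum.swap)
  also have "\<dots> = (\<Sum>T\<in>\<T>. if T \<inter> {..<i} = A \<and> set_cost c T \<le> C then principal_minor L T else 0)"
  proof (intro sum.cong refl)
    fix T assume T: "T \<in> \<T>"
    have h: "card (T - {..<i}) < ?m + 1"
      using card_mono[of "{..<?m}" "T - {..<i}"] T by (auto simp: \<T>_def less_Suc_eq_le)
    have "cond g (e T) \<longleftrightarrow> g = card (T - {..<i}) \<and> T \<inter> {..<i} = A \<and> set_cost c T \<le> C" if "g < ?m + 1" for g
      using exponent_decode[of T c i A g C] T A that by (simp add: cond_def Let_def e[OF T] \<T>_def)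
    then have "(\<Sum>g<?m + 1. if cond g (e T) then principal_minor L T else 0)
       = (\<Sum>g<?m + 1. if g = card (T - {..<i}) then
            (if T \<inter> {..<i} = A \<and> set_cost c T \<le> C then principal_minor L T else 0) else 0)"
      by (intro sum.cong) auto
    then show "(\<Sum>g<?m + 1. if cond g (e T) then principal_minor L T else 0)
        = (if T \<inter> {..<i} = A \<and> set_cost c T \<le> C then principal_minor L T else 0)" using h by simp
  qed
  also have "\<dots> = (\<Sum>T | T \<in> \<T> \<and> T \<inter> {..<i} = A \<and> set_cost c T \<le> C. principal_minor L T)"
    using fin by (subst sum.inter_filter[symmetric]) auto
  also have "\<dots> = weight L c C A i"
    unfolding weight_def feasible_sets_def \<T>_def by (intro sum.cong) auto
  finally show ?thesis by simp
qed

section \<open>Weights along the sequence of decisions\<close>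

lemma finite_feasible_sets: "finite (feasible_sets c C)"
  unfolding feasible_sets_def by (rule finite_subset[of _ "Pow {..<dim_vec c}"]) auto

lemma inter_lessThan_Suc_iff:
  assumes "A \<subseteq> {..<i}"
  shows "T \<inter> {..<i} = A \<longleftrightarrow> T \<inter> {..<Suc i} = A \<or> T \<inter> {..<Suc i} = insert i A"
proof (cases "i \<in> T")
  case True
  then have "T \<inter> {..<Suc i} = insert i (T \<inter> {..<i})" by (auto simp: lessThan_Suc)
  then show ?thesis using assms insert_ident[of i "T \<inter> {..<i}" A] by auto
next
  case False
  then have "T \<inter> {..<Suc i} = T \<inter> {..<i}" by (auto simp: lessThan_Suc)
  then show ?thesis using False by auto
qed

lemma weight_split:
  assumes "A \<subseteq> {..<i}"
  shows "weight L c C A i = weight L c C A (Suc i) + weight L c C (insert i A) (Suc i)"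
proof -
  have "{T. T \<in> feasible_sets c C \<and> T \<inter> {..<i} = A} =
      {T. T \<in> feasible_sets c C \<and> T \<inter> {..<Suc i} = A} \<union>
      {T. T \<in> feasible_sets c C \<and> T \<inter> {..<Suc i} = insert i A}" (is "?X = ?Y \<union> ?Z")
    using inter_lessThan_Suc_iff[OF assms] by blast
  moreover have "?Y \<inter> ?Z = {}" using assms by auto
  ultimately show ?thesis
    unfolding weight_def using finite_feasible_sets[of c C] by (simp add: sum.union_disjoint)
qed

lemma weight_nonneg:
  assumes "L \<in> carrier_mat (dim_vec c) (dim_vec c)" "positive_semidefinite L"
  shows "0 \<le> weight L c C A i"
  unfolding weight_def
  by (intro sum_nonneg principal_minor_nonneg[OF assms])
     (auto simp: feasible_sets_def atLeast0LessThan)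

lemma weight_zero: "weight L c C {} 0 = normalizing_sum L c C"
  by (simp add: weight_def normalizing_sum_def)

lemma weight_full:
  assumes "A \<subseteq> {..<dim_vec c}"
  shows "weight L c C A (dim_vec c) = (if A \<in> feasible_sets c C then principal_minor L A else 0)"
proof -
  have "{T. T \<in> feasible_sets c C \<and> T \<inter> {..<dim_vec c} = A}
      = (if A \<in> feasible_sets c C then {A} else {})"
    using assms by (auto simp: feasible_sets_def Int_absorb2)
  then show ?thesis by (simp add: weight_def)
qed

section \<open>Deterministic programs with counting loops\<close>

text \<open>A fragment without coin tosses whose only loops are counting loops: the final store is a
  function of the initial one, and termination and running time follow from the syntax.\<close>

datatype prog =
    PSkip
  | PInt vname "iexp list" iexp
  | PReal vname "iexp list" rexp
  | PSeq prog prog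
  | PCond bexp prog prog
  | PFor vname vname prog

definition for_com :: "vname \<Rightarrow> vname \<Rightarrow> com \<Rightarrow> com" where
  "for_com x n p = Seq (IAssign x [] (IConst 0)) (Loop (ILess (IVar x []) (IVar n []))
     (Seq p (IAssign x [] (IAdd (IVar x []) (IConst 1)))))"

fun compile :: "prog \<Rightarrow> com" where
  "compile PSkip = Skip"
| "compile (PInt x es a) = IAssign x es a"
| "compile (PReal x es a) = RAssign x es a"
| "compile (PSeq p q) = Seq (compile p) (compile q)"
| "compile (PCond b p q) = Cond b (compile p) (compile q)"
| "compile (PFor x n p) = for_com x n (compile p)"

text \<open>The number of iterations is fixed on entry to a loop, although \<open>for_com\<close>
  reads the bound again in every test; \<open>proper\<close> ensures that this agrees. A negative
  bound gives 0 iterations in both.\<close>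

fun sem :: "prog \<Rightarrow> store \<Rightarrow> store" where
  "sem PSkip s = s"
| "sem (PInt x es a) s = iupdate x (map (ival s) es) (ival s a) s"
| "sem (PReal x es a) s = rupdate x (map (ival s) es) (rval s a) s"
| "sem (PSeq p q) s = sem q (sem p s)"
| "sem (PCond b p q) s = (if bval s b then sem p s else sem q s)"
| "sem (PFor x n p) s = ((\<lambda>s. let s' = sem p s in iupdate x [] (ints s' x [] + 1) s')
     ^^ nat (ints s n [])) (iupdate x [] 0 s)"

fun int_writes :: "prog \<Rightarrow> vname set" where
  "int_writes PSkip = {}"
| "int_writes (PInt x es a) = {x}"
| "int_writes (PReal x es a) = {}"
| "int_writes (PSeq p q) = int_writes p \<union> int_writes q"
| "int_writes (PCond b p q) = int_writes p \<union> int_writes q"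
| "int_writes (PFor x n p) = insert x (int_writes p)"

fun real_writes :: "prog \<Rightarrow> vname set" where
  "real_writes PSkip = {}"
| "real_writes (PInt x es a) = {}"
| "real_writes (PReal x es a) = {x}"
| "real_writes (PSeq p q) = real_writes p \<union> real_writes q"
| "real_writes (PCond b p q) = real_writes p \<union> real_writes q"
| "real_writes (PFor x n p) = real_writes p"

fun loop_bounds :: "prog \<Rightarrow> vname set" where
  "loop_bounds PSkip = {}"
| "loop_bounds (PInt x es a) = {}"
| "loop_bounds (PReal x es a) = {}"
| "loop_bounds (PSeq p q) = loop_bounds p \<union> loop_bounds q"
| "loop_bounds (PCond b p q) = loop_bounds p \<union> loop_bounds q"
| "loop_bounds (PFor x n p) = insert n (loop_bounds p)"

fun proper :: "prog \<Rightarrow> bool" where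
  "proper (PSeq p q) \<longleftrightarrow> proper p \<and> proper q"
| "proper (PCond b p q) \<longleftrightarrow> proper p \<and> proper q"
| "proper (PFor x n p) \<longleftrightarrow> x \<notin> int_writes p \<and> n \<notin> int_writes p \<and> n \<noteq> x \<and> proper p"
| "proper _ \<longleftrightarrow> True"

text \<open>A bound on the running time when no loop makes more than \<open>B\<close> iterations.\<close>

fun time_bound :: "nat \<Rightarrow> prog \<Rightarrow> nat" where
  "time_bound B PSkip = 1"
| "time_bound B (PInt x es a) = 1 + sum_list (map icost es) + icost a"
| "time_bound B (PReal x es a) = 1 + sum_list (map icost es) + rcost a"
| "time_bound B (PSeq p q) = time_bound B p + time_bound B q"
| "time_bound B (PCond b p q) = bcost b + (time_bound B p + time_bound B q)"
| "time_bound B (PFor x n p) = 5 + B * (time_bound B p + 7)"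

lemma ints_iupdate [simp]:
  "ints (iupdate x is v s) = (ints s)(x := (ints s x)(is := v))"
  by (simp add: iupdate_def)

lemma reals_iupdate [simp]: "reals (iupdate x is v s) = reals s"
  by (simp add: iupdate_def)

lemma reals_rupdate [simp]:
  "reals (rupdate x is v s) = (reals s)(x := (reals s x)(is := v))"
  by (simp add: rupdate_def)

lemma ints_rupdate [simp]: "ints (rupdate x is v s) = ints s"
  by (simp add: rupdate_def)

lemma ints_sem_notin: "x \<notin> int_writes p \<Longrightarrow> ints (sem p s) x = ints s x"
proof (induction p arbitrary: s)
  case (PFor y n p)
  have "ints (((\<lambda>s. let s' = sem p s in iupdate y [] (ints s' y [] + 1) s') ^^ k) s) x = ints s x" for k s
    using PFor by (induction k) (auto simp: Let_def)
  then show ?case using PFor.prems by simp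
qed auto

lemma reals_sem_notin: "x \<notin> real_writes p \<Longrightarrow> reals (sem p s) x = reals s x"
proof (induction p arbitrary: s)
  case (PFor y n p)
  have "reals (((\<lambda>s. let s' = sem p s in iupdate y [] (ints s' y [] + 1) s') ^^ k) s) x = reals s x" for k s
    using PFor by (induction k) (auto simp: Let_def)
  then show ?case using PFor.prems by simp
qed auto

text \<open>The invariant rule for counting loops: \<open>I k\<close> describes the store after
  \<open>k\<close> iterations, with the counter already set to \<open>k\<close>. The values of
  counter and bound come for free because \<open>proper\<close> protects both from the body.\<close>

lemma sem_PFor:
  assumes proper: "proper (PFor x n p)" and n: "ints s n [] = int N"
    and init: "I 0 (iupdate x [] 0 s)"
    and step: "\<And>k s'. k < N \<Longrightarrow> I k s' \<Longrightarrow> ints s' x [] = int k \<Longrightarrow> ints s' n [] = int N \<Longrightarrow>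
      I (Suc k) (iupdate x [] (int (Suc k)) (sem p s'))"
  shows "I N (sem (PFor x n p) s)"
proof -
  let ?f = "\<lambda>s. let s' = sem p s in iupdate x [] (ints s' x [] + 1) s'"
  have "k \<le> N \<Longrightarrow> I k ((?f ^^ k) (iupdate x [] 0 s)) \<and> ints ((?f ^^ k) (iupdate x [] 0 s)) x [] = int k
     \<and> ints ((?f ^^ k) (iupdate x [] 0 s)) n [] = int N" for k
  proof (induction k)
    case 0
    show ?case using init n proper by simp
  next
    case (Suc k)
    define s' where "s' = (?f ^^ k) (iupdate x [] 0 s)"
    have s': "I k s'" "ints s' x [] = int k" "ints s' n [] = int N"
      using Suc by (simp_all add: s'_def)
    then have "I (Suc k) (iupdate x [] (int (Suc k)) (sem p s'))"
      using step Suc.prems by simp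
    moreover have "?f s' = iupdate x [] (int (Suc k)) (sem p s')"
      using proper s' by (simp add: Let_def ints_sem_notin add.commute)
    moreover have "ints (?f s') n [] = int N"
      using proper s' by (simp add: Let_def ints_sem_notin)
    moreover have "(?f ^^ Suc k) (iupdate x [] 0 s) = ?f s'" by (simp add: s'_def)
    ultimately show ?case using proper by simp
  qed
  then show ?thesis using n by simp
qed

lemma charge_return [simp]: "charge k (return_pmf (s, t)) = return_pmf (s, k + t)"
  by (simp add: charge_def)

lemma and_then_return [simp]: "and_then (return_pmf (s, t)) K = charge t (K s)"
  by (simp add: and_then_def bind_return_pmf)

lemma exec_Seq_return:
  assumes "exec p s (return_pmf (s', t))" "exec q s' (return_pmf (s'', t'))"
  shows "exec (Seq p q) s (return_pmf (s'', t + t'))"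
  using exec.Seq[OF assms(1), of q "\<lambda>_. return_pmf (s'', t')"] assms(2) by auto

lemma exec_LoopTrue_return:
  assumes "bval s b" "exec p s (return_pmf (s', t))" "exec (Loop b p) s' (return_pmf (s'', t'))"
  shows "exec (Loop b p) s (return_pmf (s'', bcost b + (t + t')))"
  using exec.LoopTrue[OF assms(1,2), of "\<lambda>_. return_pmf (s'', t')"] assms(3) by auto

text \<open>By structural induction. Since no loop bound is ever written, the limit \<open>B\<close>
  on the initial values of the bounds holds for inner loops as well.\<close>

lemma exec_compile:
  assumes "proper p" "loop_bounds p \<inter> int_writes p = {}"
    and "\<And>n. n \<in> loop_bounds p \<Longrightarrow> ints s n [] \<le> int B"
  shows "\<exists>t. exec (compile p) s (return_pmf (sem p s, t)) \<and> t \<le> time_bound B p"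
  using assms
proof (induction p arbitrary: s)
  case PSkip
  then show ?case by (auto intro: exec.Skip)
next
  case (PInt x es a)
  then show ?case by (auto intro: exec.IAssign)
next
  case (PReal x es a)
  then show ?case by (auto intro: exec.RAssign)
next
  case (PSeq p q)
  obtain t where t: "exec (compile p) s (return_pmf (sem p s, t))" "t \<le> time_bound B p"
    using PSeq.IH(1)[of s] PSeq.prems by auto
  have "ints (sem p s) n [] \<le> int B" if "n \<in> loop_bounds q" for n
    using PSeq.prems(2) PSeq.prems(3)[of n] that by (subst ints_sem_notin) auto
  then obtain t' where "exec (compile q) (sem p s) (return_pmf (sem q (sem p s), t'))" "t' \<le> time_bound B q"
    using PSeq.IH(2)[of "sem p s"] PSeq.prems by auto
  then show ?case using exec_Seq_return[OF t(1)] t(2) by fastforce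
next
  case (PCond b p q)
  obtain t where t: "exec (compile p) s (return_pmf (sem p s, t))" "t \<le> time_bound B p"
    using PCond.IH(1)[of s] PCond.prems by auto
  obtain t' where t': "exec (compile q) s (return_pmf (sem q s, t'))" "t' \<le> time_bound B q"
    using PCond.IH(2)[of s] PCond.prems by auto
  show ?case
  proof (cases "bval s b")
    case True
    then show ?thesis using exec.CondTrue[OF True t(1), of "compile q"] t(2) by auto
  next
    case False
    then show ?thesis using exec.CondFalse[OF False t'(1), of "compile p"] t'(2) by auto
  qed
next
  case (PFor x n p)
  let ?f = "\<lambda>s. let s' = sem p s in iupdate x [] (ints s' x [] + 1) s'"
  let ?b = "ILess (IVar x []) (IVar n [])"
  let ?p = "Seq (compile p) (IAssign x [] (IAdd (IVar x []) (IConst 1)))"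
  \<comment> \<open>Only the number \<open>k\<close> of remaining iterations matters, so the counter
    may start anywhere. The 7 units are 3 for the test and 4 for the increment; the final 3 are the
    failing test.\<close>
  have loop: "\<exists>t. exec (Loop ?b ?p) s (return_pmf ((?f ^^ k) s, t)) \<and> t \<le> k * (time_bound B p + 7) + 3"
    if "ints s n [] - ints s x [] = int k" "\<And>n. n \<in> loop_bounds p \<Longrightarrow> ints s n [] \<le> int B" for k s
    using that
  proof (induction k arbitrary: s)
    case 0
    then have "\<not> bval s ?b" by simp
    from exec.LoopFalse[OF this, of ?p] show ?case by (intro exI[of _ "bcost ?b"]) simp
  next
    case (Suc k)
    obtain t where t: "exec (compile p) s (return_pmf (sem p s, t))" "t \<le> time_bound B p"
      using PFor.IH[of s] PFor.prems Suc.prems by auto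
    have "exec ?p s (return_pmf (?f s, t + 4))"
      using exec_Seq_return[OF t(1) exec.IAssign[of x "[]" "IAdd (IVar x []) (IConst 1)" "sem p s"]]
      by (simp add: Let_def numeral_eq_Suc)
    moreover have "ints (?f s) n [] - ints (?f s) x [] = int k"
      using Suc.prems PFor.prems by (simp add: Let_def ints_sem_notin)
    moreover have "ints (?f s) n' [] \<le> int B" if n': "n' \<in> loop_bounds p" for n'
    proof -
      have "n' \<notin> int_writes p" "n' \<noteq> x" using PFor.prems(2) n' by auto
      then show ?thesis using Suc.prems(2)[OF n'] by (simp add: Let_def ints_sem_notin)
    qed
    ultimately obtain t' where t': "exec (Loop ?b ?p) (?f s) (return_pmf ((?f ^^ k) (?f s), t'))"
        "t' \<le> k * (time_bound B p + 7) + 3"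
      using Suc.IH[of "?f s"] by blast
    have b: "bval s ?b" using Suc.prems by simp
    have eq: "(?f ^^ Suc k) s = (?f ^^ k) (?f s)" by (simp only: funpow_Suc_right o_apply)
    show ?case
      unfolding eq
    proof (intro exI conjI)
      show "exec (Loop ?b ?p) s (return_pmf ((?f ^^ k) (?f s), bcost ?b + (t + 4 + t')))"
        by (rule exec_LoopTrue_return[OF b \<open>exec ?p s _\<close> t'(1)])
    qed (use t(2) t'(2) in simp)
  qed
  define k where "k = nat (ints s n [])"
  define s0 where "s0 = iupdate x [] 0 s"
  have assign: "exec (IAssign x [] (IConst 0)) s (return_pmf (s0, 2))"
    using exec.IAssign[of x "[]" "IConst 0" s] by (simp add: s0_def numeral_2_eq_2)
  have bounds: "ints s0 n' [] \<le> int B" if "n' \<in> loop_bounds p" for n'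
    using PFor.prems(2) PFor.prems(3)[of n'] that by (auto simp: s0_def)
  have "\<exists>t. exec (Loop ?b ?p) s0 (return_pmf ((?f ^^ k) s0, t)) \<and> t \<le> k * (time_bound B p + 7) + 3"
  proof (cases "0 \<le> ints s n []")
    case True
    then show ?thesis using loop[of s0 k] bounds PFor.prems(1) by (simp add: k_def s0_def)
  next
    case False
    then have "\<not> bval s0 ?b" using PFor.prems(1) by (simp add: s0_def)
    from exec.LoopFalse[OF this, of ?p] show ?thesis
      using False by (intro exI[of _ "bcost ?b"]) (simp add: k_def)
  qed
  then obtain t where t: "exec (Loop ?b ?p) s0 (return_pmf ((?f ^^ k) s0, t))"
    "t \<le> k * (time_bound B p + 7) + 3" by blast
  have "k \<le> B" using PFor.prems(3)[of n] by (simp add: k_def)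
  then have "k * (time_bound B p + 7) \<le> B * (time_bound B p + 7)" by simp
  then have "2 + t \<le> time_bound B (PFor x n p)"
    using t(2) unfolding time_bound.simps by linarith
  then show ?case
    using exec_Seq_return[OF assign t(1)]
    by (intro exI[of _ "2 + t"] conjI) (simp_all add: for_com_def k_def s0_def)
qed

section \<open>Time bounds as polynomials in two variables\<close>

definition bivariate :: "(nat \<Rightarrow> nat \<Rightarrow> nat) \<Rightarrow> bool" where
  "bivariate f \<longleftrightarrow> (\<exists>P. \<forall>x y. f x y = poly2 P x y)"

lemma bivariate_const: "bivariate (\<lambda>x y. k)"
  unfolding bivariate_def by (intro exI[of _ "[:[:k:]:]"]) (simp add: poly2_def)

lemma bivariate_fst: "bivariate (\<lambda>x y. x)"
  unfolding bivariate_def by (intro exI[of _ "[:[:0, 1:]:]"]) (simp add: poly2_def)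

lemma bivariate_snd: "bivariate (\<lambda>x y. y)"
  unfolding bivariate_def by (intro exI[of _ "[:0, 1:]"]) (simp add: poly2_def)

lemma bivariate_add:
  assumes "bivariate f" "bivariate g"
  shows "bivariate (\<lambda>x y. f x y + g x y)"
proof -
  obtain P Q where "\<forall>x y. f x y = poly2 P x y" "\<forall>x y. g x y = poly2 Q x y"
    using assms unfolding bivariate_def by blast
  then show ?thesis
    unfolding bivariate_def by (intro exI[of _ "P + Q"]) (simp add: poly2_def)
qed

lemma bivariate_mult:
  assumes "bivariate f" "bivariate g"
  shows "bivariate (\<lambda>x y. f x y * g x y)"
proof -
  obtain P Q where "\<forall>x y. f x y = poly2 P x y" "\<forall>x y. g x y = poly2 Q x y"
    using assms unfolding bivariate_def by blast
  then show ?thesis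
    unfolding bivariate_def by (intro exI[of _ "P * Q"]) (simp add: poly2_def)
qed

lemmas bivariate_intros = bivariate_const bivariate_fst bivariate_snd bivariate_add bivariate_mult

text \<open>For a fixed program the limit \<open>B\<close> enters only through sums and products
  with constants.\<close>

lemma bivariate_time_bound:
  assumes "bivariate B"
  shows "bivariate (\<lambda>x y. time_bound (B x y) p)"
  by (induction p) (auto intro!: bivariate_intros assms)

declare sem.simps(6) [simp del]

section \<open>Nested loops that fill an array\<close>

definition agree :: "vname set \<Rightarrow> vname set \<Rightarrow> store \<Rightarrow> store \<Rightarrow> bool" where
  "agree X Y s s' \<longleftrightarrow> (\<forall>x. x \<notin> X \<longrightarrow> ints s' x = ints s x) \<and> (\<forall>y. y \<notin> Y \<longrightarrow> reals s' y = reals s y)"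

lemma agree_refl [simp]: "agree X Y s s"
  by (simp add: agree_def)

lemma agree_trans: "agree X Y s s' \<Longrightarrow> agree X Y s' s'' \<Longrightarrow> agree X Y s s''"
  by (simp add: agree_def)

lemma agree_mono: "agree X Y s s' \<Longrightarrow> X \<subseteq> X' \<Longrightarrow> Y \<subseteq> Y' \<Longrightarrow> agree X' Y' s s'"
  by (auto simp: agree_def)

lemma agree_iupdate: "x \<in> X \<Longrightarrow> agree X Y s (iupdate x is v s') \<longleftrightarrow> agree X Y s s'"
  by (auto simp: agree_def)

lemma agree_sem: "agree (int_writes p) (real_writes p) s (sem p s)"
  by (simp add: agree_def ints_sem_notin reals_sem_notin)

lemma agree_ints: "agree X Y s s' \<Longrightarrow> x \<notin> X \<Longrightarrow> ints s' x = ints s x"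
  by (simp add: agree_def)

fun nest :: "(vname \<times> vname) list \<Rightarrow> prog \<Rightarrow> prog" where
  "nest [] p = p"
| "nest ((x, n) # vs) p = PFor x n (nest vs p)"

lemma int_writes_nest [simp]: "int_writes (nest vs p) = fst ` set vs \<union> int_writes p"
  by (induction vs p rule: nest.induct) auto

lemma real_writes_nest [simp]: "real_writes (nest vs p) = real_writes p"
  by (induction vs p rule: nest.induct) auto

lemma loop_bounds_nest [simp]: "loop_bounds (nest vs p) = snd ` set vs \<union> loop_bounds p"
  by (induction vs p rule: nest.induct) auto

definition grid :: "nat list \<Rightarrow> nat list set" where
  "grid Ns = {ks. list_all2 (<) ks Ns}"

lemma grid_Nil [simp]: "ks \<in> grid [] \<longleftrightarrow> ks = []"
  by (simp add: grid_def)

lemma grid_Cons: "ks \<in> grid (N # Ns) \<longleftrightarrow> (\<exists>k ks'. ks = k # ks' \<and> k < N \<and> ks' \<in> grid Ns)"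
  by (auto simp: grid_def list_all2_Cons2)

lemma ball_grid: "(\<forall>ks\<in>grid []. P ks) \<longleftrightarrow> P []"
  "(\<forall>ks\<in>grid (N # Ns). P ks) \<longleftrightarrow> (\<forall>k<N. \<forall>ks\<in>grid Ns. P (k # ks))"
  by (auto simp: grid_Cons)

text \<open>Each run of the body writes one cell of \<open>y\<close>, and distinct counter values
  give distinct cells, so nothing is overwritten. The body may rely on cells outside the grid being
  unchanged, which allows it to read another layer of the array it writes. The prefix
  \<open>pre\<close> stands for such a fixed leading index and also collects the counters of the
  outer loops in the induction.\<close>

lemma nest_fill:
  assumes "proper (nest vs p)" and "loop_bounds (nest vs p) \<inter> int_writes (nest vs p) = {}"
    and "map (\<lambda>(x, n). ints s n []) vs = map int Ns"
    and "\<And>ks s'. ks \<in> grid Ns \<Longrightarrow> agree (int_writes (nest vs p)) (real_writes p) s s' \<Longrightarrow>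
      map (\<lambda>(x, n). ints s' x []) vs = map int ks \<Longrightarrow>
      (\<And>is. is \<notin> (\<lambda>ks. pre @ map int ks) ` grid Ns \<Longrightarrow> reals s' y is = reals s y is) \<Longrightarrow>
      reals (sem p s') y = (reals s' y)(pre @ map int ks := f ks)"
  shows "(\<forall>ks \<in> grid Ns. reals (sem (nest vs p) s) y (pre @ map int ks) = f ks) \<and>
    (\<forall>is. is \<notin> (\<lambda>ks. pre @ map int ks) ` grid Ns \<longrightarrow>
      reals (sem (nest vs p) s) y is = reals s y is)"
  using assms
proof (induction vs p arbitrary: s Ns pre f rule: nest.induct)
  case (1 p)
  from "1.prems"(4)[of "[]" s] "1.prems"(3) show ?case by auto
next
  case (2 x n vs p)
  from "2.prems"(3) obtain N Ns' where Ns: "Ns = N # Ns'" "ints s n [] = int N"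
      "map (\<lambda>(x, n). ints s n []) vs = map int Ns'"
    by (cases Ns) auto
  let ?W = "int_writes (PFor x n (nest vs p))" and ?R = "real_writes p"
  let ?in = "\<lambda>is. is \<in> (\<lambda>ks. pre @ map int ks) ` grid Ns"
  define I where "I k s' \<longleftrightarrow> agree ?W ?R s s' \<and>
    (\<forall>k'<k. \<forall>ks\<in>grid Ns'. reals s' y (pre @ int k' # map int ks) = f (k' # ks)) \<and>
    (\<forall>is. \<not> ?in is \<longrightarrow> reals s' y is = reals s y is)" for k s'
  have proper: "proper (PFor x n (nest vs p))" using "2.prems"(1) by simp
  have bounds: "insert n (loop_bounds (nest vs p)) \<inter> insert x (int_writes (nest vs p)) = {}"
    using "2.prems"(2) by simp
  have "I N (sem (PFor x n (nest vs p)) s)"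
  proof (rule sem_PFor[OF proper Ns(2)])
    show "I 0 (iupdate x [] 0 s)" by (simp add: I_def agree_iupdate)
    fix k s' assume k: "k < N" and I: "I k s'" and x: "ints s' x [] = int k"
    have ag: "agree ?W ?R s s'" using I by (simp add: I_def)
    \<comment> \<open>The inner loops fill the cells with prefix
      \<open>pre @ [int k]\<close>.\<close>
    have "(\<forall>ks \<in> grid Ns'. reals (sem (nest vs p) s') y ((pre @ [int k]) @ map int ks) = f (k # ks)) \<and>
      (\<forall>is. is \<notin> (\<lambda>ks. (pre @ [int k]) @ map int ks) ` grid Ns' \<longrightarrow>
        reals (sem (nest vs p) s') y is = reals s' y is)"
    proof (rule "2.IH")
      show "proper (nest vs p)" using proper by simp
      show "loop_bounds (nest vs p) \<inter> int_writes (nest vs p) = {}" using bounds by auto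
      have "ints s' n' = ints s n'" if "n' \<in> snd ` set vs" for n'
      proof (rule agree_ints[OF ag])
        have "n' \<in> loop_bounds (nest vs p)" using that by simp
        then show "n' \<notin> ?W" using bounds by auto
      qed
      then have "map (\<lambda>(x, n). ints s' n []) vs = map (\<lambda>(x, n). ints s n []) vs"
        by (intro map_cong refl) force
      then show "map (\<lambda>(x, n). ints s' n []) vs = map int Ns'" using Ns(3) by simp
    next
      fix ks s'' assume ks: "ks \<in> grid Ns'"
        and ag': "agree (int_writes (nest vs p)) (real_writes p) s' s''"
        and vars: "map (\<lambda>(x, n). ints s'' x []) vs = map int ks"
        and out: "\<And>is. is \<notin> (\<lambda>ks. (pre @ [int k]) @ map int ks) ` grid Ns' \<Longrightarrow>
          reals s'' y is = reals s' y is"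
      have "reals (sem p s'') y = (reals s'' y)(pre @ map int (k # ks) := f (k # ks))"
      proof (rule "2.prems"(4))
        show "k # ks \<in> grid Ns" using ks k Ns by (simp add: grid_Cons)
        show "agree (int_writes (nest ((x, n) # vs) p)) (real_writes p) s s''"
          using agree_trans[OF ag agree_mono[OF ag']] by auto
        have "ints s'' x = ints s' x" using ag' proper by (auto intro: agree_ints)
        then show "map (\<lambda>(x, n). ints s'' x []) ((x, n) # vs) = map int (k # ks)"
          using vars x by simp
        fix js assume js: "js \<notin> (\<lambda>ks. pre @ map int ks) ` grid Ns"
        have "js \<notin> (\<lambda>ks. (pre @ [int k]) @ map int ks) ` grid Ns'"
        proof
          assume "js \<in> (\<lambda>ks. (pre @ [int k]) @ map int ks) ` grid Ns'"
          then obtain ks' where "ks' \<in> grid Ns'" "js = pre @ map int (k # ks')" by auto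
          moreover from this k have "k # ks' \<in> grid Ns" by (simp add: Ns(1) grid_Cons)
          ultimately show False using js by blast
        qed
        then show "reals s'' y js = reals s y js" using out js I by (simp add: I_def)
      qed
      then show "reals (sem p s'') y = (reals s'' y)((pre @ [int k]) @ map int ks := f (k # ks))"
        by simp
    qed
    then have new: "\<And>ks. ks \<in> grid Ns' \<Longrightarrow> reals (sem (nest vs p) s') y (pre @ int k # map int ks) = f (k # ks)"
      and old: "\<And>js. js \<notin> (\<lambda>ks. pre @ int k # map int ks) ` grid Ns' \<Longrightarrow>
        reals (sem (nest vs p) s') y js = reals s' y js"
      by simp_all
    show "I (Suc k) (iupdate x [] (int (Suc k)) (sem (nest vs p) s'))"
      unfolding I_def
    proof (intro conjI allI impI ballI)
      have "agree ?W ?R s' (sem (nest vs p) s')" by (rule agree_mono[OF agree_sem]) auto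
      then show "agree ?W ?R s (iupdate x [] (int (Suc k)) (sem (nest vs p) s'))"
        using agree_trans[OF ag] by (simp add: agree_iupdate)
    next
      fix k' ks assume k': "k' < Suc k" and ks: "ks \<in> grid Ns'"
      show "reals (iupdate x [] (int (Suc k)) (sem (nest vs p) s')) y (pre @ int k' # map int ks) = f (k' # ks)"
      proof (cases "k' = k")
        case True
        then show ?thesis using new[OF ks] by simp
      next
        case False
        \<comment> \<open>A cell from an earlier round has a different index in the position of
          \<open>k\<close> and is therefore outside the inner grid.\<close>
        then have "reals (sem (nest vs p) s') y (pre @ int k' # map int ks)
            = reals s' y (pre @ int k' # map int ks)" by (intro old) auto
        then show ?thesis using I k' ks False by (simp add: I_def)
      qed
    next
      fix js assume js: "\<not> ?in js"
      have "js \<notin> (\<lambda>ks. pre @ int k # map int ks) ` grid Ns'"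
      proof
        assume "js \<in> (\<lambda>ks. pre @ int k # map int ks) ` grid Ns'"
        then obtain ks' where "ks' \<in> grid Ns'" "js = pre @ map int (k # ks')" by auto
        moreover from this k have "k # ks' \<in> grid Ns" by (simp add: Ns(1) grid_Cons)
        ultimately show False using js by blast
      qed
      then show "reals (iupdate x [] (int (Suc k)) (sem (nest vs p) s')) y js = reals s y js"
        using old I js by (simp add: I_def)
    qed
  qed
  then show ?case by (auto simp: I_def Ns(1) grid_Cons)
qed

text \<open>This and the next two lemmas are \<open>nest_fill\<close> at depths 1 to 3, with
  counters as separate arguments instead of a list.\<close>

lemma nest_fill1:
  assumes "proper (nest [(x, n)] p)" and "loop_bounds (nest [(x, n)] p) \<inter> int_writes (nest [(x, n)] p) = {}"
    and "ints s n [] = int N"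
    and "\<And>k s'. k < N \<Longrightarrow> agree (int_writes (nest [(x, n)] p)) (real_writes p) s s' \<Longrightarrow>
      ints s' x [] = int k \<Longrightarrow>
      (\<forall>is. (\<forall>k<N. is \<noteq> pre @ [int k]) \<longrightarrow> reals s' y is = reals s y is) \<Longrightarrow>
      reals (sem p s') y = (reals s' y)(pre @ [int k] := f k)"
  shows "\<And>k. k < N \<Longrightarrow> reals (sem (nest [(x, n)] p) s) y (pre @ [int k]) = f k"
proof -
  have "(\<forall>ks \<in> grid [N]. reals (sem (nest [(x, n)] p) s) y (pre @ map int ks) = f (ks ! 0)) \<and>
    (\<forall>is. is \<notin> (\<lambda>ks. pre @ map int ks) ` grid [N] \<longrightarrow>
      reals (sem (nest [(x, n)] p) s) y is = reals s y is)"
  proof (rule nest_fill[OF assms(1,2)])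
    fix ks s' assume "ks \<in> grid [N]"
      and ag: "agree (int_writes (nest [(x, n)] p)) (real_writes p) s s'"
      and vars: "map (\<lambda>(x, n). ints s' x []) [(x, n)] = map int ks"
      and out: "\<And>is. is \<notin> (\<lambda>ks. pre @ map int ks) ` grid [N] \<Longrightarrow> reals s' y is = reals s y is"
    then obtain k where ks: "ks = [k]" "k < N"
      by (auto simp: grid_Cons)
    have "reals (sem p s') y = (reals s' y)(pre @ [int k] := f k)"
      by (rule assms(4)[OF ks(2-) ag]) (use vars ks out in \<open>auto simp: ball_grid image_iff\<close>)
    then show "reals (sem p s') y = (reals s' y)(pre @ map int ks := f (ks ! 0))" by (simp add: ks)
  qed (use assms(3-) in simp)
  then show "\<And>k. k < N \<Longrightarrow> reals (sem (nest [(x, n)] p) s) y (pre @ [int k]) = f k"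
    by (auto simp: ball_grid image_iff)
qed

lemma nest_fill2:
  assumes "proper (nest [(x1, n1), (x2, n2)] p)"
    and "loop_bounds (nest [(x1, n1), (x2, n2)] p) \<inter> int_writes (nest [(x1, n1), (x2, n2)] p) = {}"
    and "ints s n1 [] = int N1" "ints s n2 [] = int N2"
    and "\<And>k l s'. k < N1 \<Longrightarrow> l < N2 \<Longrightarrow>
      agree (int_writes (nest [(x1, n1), (x2, n2)] p)) (real_writes p) s s' \<Longrightarrow>
      ints s' x1 [] = int k \<Longrightarrow> ints s' x2 [] = int l \<Longrightarrow>
      (\<forall>is. (\<forall>k<N1. \<forall>l<N2. is \<noteq> pre @ [int k, int l]) \<longrightarrow> reals s' y is = reals s y is) \<Longrightarrow>
      reals (sem p s') y = (reals s' y)(pre @ [int k, int l] := f k l)"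
  shows "\<And>k l. k < N1 \<Longrightarrow> l < N2 \<Longrightarrow>
      reals (sem (nest [(x1, n1), (x2, n2)] p) s) y (pre @ [int k, int l]) = f k l"
proof -
  have "(\<forall>ks \<in> grid [N1, N2]. reals (sem (nest [(x1, n1), (x2, n2)] p) s) y (pre @ map int ks)
        = f (ks ! 0) (ks ! 1)) \<and>
    (\<forall>is. is \<notin> (\<lambda>ks. pre @ map int ks) ` grid [N1, N2] \<longrightarrow>
      reals (sem (nest [(x1, n1), (x2, n2)] p) s) y is = reals s y is)"
  proof (rule nest_fill[OF assms(1,2)])
    fix ks s' assume "ks \<in> grid [N1, N2]"
      and ag: "agree (int_writes (nest [(x1, n1), (x2, n2)] p)) (real_writes p) s s'"
      and vars: "map (\<lambda>(x, n). ints s' x []) [(x1, n1), (x2, n2)] = map int ks"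
      and out: "\<And>is. is \<notin> (\<lambda>ks. pre @ map int ks) ` grid [N1, N2] \<Longrightarrow> reals s' y is = reals s y is"
    then obtain k l where ks: "ks = [k, l]" "k < N1" "l < N2"
      by (auto simp: grid_Cons)
    have "reals (sem p s') y = (reals s' y)(pre @ [int k, int l] := f k l)"
      by (rule assms(5)[OF ks(2-) ag]) (use vars ks out in \<open>auto simp: ball_grid image_iff\<close>)
    then show "reals (sem p s') y = (reals s' y)(pre @ map int ks := f (ks ! 0) (ks ! 1))" by (simp add: ks)
  qed (use assms(3-) in simp)
  then show "\<And>k l. k < N1 \<Longrightarrow> l < N2 \<Longrightarrow>
      reals (sem (nest [(x1, n1), (x2, n2)] p) s) y (pre @ [int k, int l]) = f k l"
    by (auto simp: ball_grid image_iff)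
qed

lemma nest_fill3:
  assumes "proper (nest [(x1, n1), (x2, n2), (x3, n3)] p)"
    and "loop_bounds (nest [(x1, n1), (x2, n2), (x3, n3)] p) \<inter>
      int_writes (nest [(x1, n1), (x2, n2), (x3, n3)] p) = {}"
    and "ints s n1 [] = int N1" "ints s n2 [] = int N2" "ints s n3 [] = int N3"
    and "\<And>k l q s'. k < N1 \<Longrightarrow> l < N2 \<Longrightarrow> q < N3 \<Longrightarrow>
      agree (int_writes (nest [(x1, n1), (x2, n2), (x3, n3)] p)) (real_writes p) s s' \<Longrightarrow>
      ints s' x1 [] = int k \<Longrightarrow> ints s' x2 [] = int l \<Longrightarrow> ints s' x3 [] = int q \<Longrightarrow>
      (\<forall>is. (\<forall>k<N1. \<forall>l<N2. \<forall>q<N3. is \<noteq> pre @ [int k, int l, int q]) \<longrightarrow>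
        reals s' y is = reals s y is) \<Longrightarrow>
      reals (sem p s') y = (reals s' y)(pre @ [int k, int l, int q] := f k l q)"
  shows "\<And>k l q. k < N1 \<Longrightarrow> l < N2 \<Longrightarrow> q < N3 \<Longrightarrow>
      reals (sem (nest [(x1, n1), (x2, n2), (x3, n3)] p) s) y (pre @ [int k, int l, int q]) = f k l q"
proof -
  have "(\<forall>ks \<in> grid [N1, N2, N3]. reals (sem (nest [(x1, n1), (x2, n2), (x3, n3)] p) s) y (pre @ map int ks)
        = f (ks ! 0) (ks ! 1) (ks ! 2)) \<and>
    (\<forall>is. is \<notin> (\<lambda>ks. pre @ map int ks) ` grid [N1, N2, N3] \<longrightarrow>
      reals (sem (nest [(x1, n1), (x2, n2), (x3, n3)] p) s) y is = reals s y is)"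
  proof (rule nest_fill[OF assms(1,2)])
    fix ks s' assume "ks \<in> grid [N1, N2, N3]"
      and ag: "agree (int_writes (nest [(x1, n1), (x2, n2), (x3, n3)] p)) (real_writes p) s s'"
      and vars: "map (\<lambda>(x, n). ints s' x []) [(x1, n1), (x2, n2), (x3, n3)] = map int ks"
      and out: "\<And>is. is \<notin> (\<lambda>ks. pre @ map int ks) ` grid [N1, N2, N3] \<Longrightarrow> reals s' y is = reals s y is"
    then obtain k l q where ks: "ks = [k, l, q]" "k < N1" "l < N2" "q < N3"
      by (auto simp: grid_Cons)
    have "reals (sem p s') y = (reals s' y)(pre @ [int k, int l, int q] := f k l q)"
      by (rule assms(6)[OF ks(2-) ag]) (use vars ks out in \<open>auto simp: ball_grid image_iff\<close>)
    then show "reals (sem p s') y = (reals s' y)(pre @ map int ks := f (ks ! 0) (ks ! 1) (ks ! 2))" by (simp add: ks)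
  qed (use assms(3-) in simp)
  then show "\<And>k l q. k < N1 \<Longrightarrow> l < N2 \<Longrightarrow> q < N3 \<Longrightarrow>
      reals (sem (nest [(x1, n1), (x2, n2), (x3, n3)] p) s) y (pre @ [int k, int l, int q]) = f k l q"
    by (auto simp: ball_grid image_iff)
qed

lemma iupdate_rupdate [simp]: "iupdate x is v (rupdate y js r s) = rupdate y js r (iupdate x is v s)"
  by (simp add: iupdate_def rupdate_def)

lemma iupdate_iupdate [simp]: "iupdate x is v (iupdate x is v' s) = iupdate x is v s"
  by (simp add: iupdate_def)

lemma rupdate_rupdate [simp]: "rupdate x is v (rupdate x is v' s) = rupdate x is v s"
  by (simp add: rupdate_def)

lemma rupdate_same: "reals s x is = v \<Longrightarrow> rupdate x is v s = s"
  by (auto simp: rupdate_def)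

definition acc_loop :: "vname \<Rightarrow> vname \<Rightarrow> bexp \<Rightarrow> rexp \<Rightarrow> prog" where
  "acc_loop x n b e = PFor x n (PCond b (PReal ''acc'' [] (RAdd (RVar ''acc'' []) e)) PSkip)"

lemma acc_loop_syntax [simp]:
  "int_writes (acc_loop x n b e) = {x}" "real_writes (acc_loop x n b e) = {''acc''}"
  "loop_bounds (acc_loop x n b e) = {n}" "proper (acc_loop x n b e) \<longleftrightarrow> n \<noteq> x"
  by (auto simp: acc_loop_def)

text \<open>As \<open>b\<close> and \<open>e\<close> do not read the accumulator, every summand can
  be evaluated in the initial store. The whole final store is given, so that the statements after
  the loop can be evaluated by rewriting.\<close>

lemma sem_acc_loop:
  assumes "x \<noteq> n" and n: "ints s n [] = int N"
    and e: "\<And>r s. rval (rupdate ''acc'' [] r s) e = rval s e"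
    and b: "\<And>r s. bval (rupdate ''acc'' [] r s) b = bval s b"
  shows "sem (acc_loop x n b e) s = rupdate ''acc'' []
    (reals s ''acc'' [] + (\<Sum>k<N. if bval (iupdate x [] (int k) s) b then rval (iupdate x [] (int k) s) e else 0))
    (iupdate x [] (int N) s)"
proof -
  define I where "I k s' \<longleftrightarrow> s' = rupdate ''acc'' []
    (reals s ''acc'' [] + (\<Sum>j<k. if bval (iupdate x [] (int j) s) b then rval (iupdate x [] (int j) s) e else 0))
    (iupdate x [] (int k) s)" for k s'
  have "I N (sem (acc_loop x n b e) s)"
    unfolding acc_loop_def
    by (rule sem_PFor[OF _ n]) (use assms(1) in \<open>auto simp: I_def e b rupdate_same add.assoc\<close>)
  then show ?thesis by (simp add: I_def)
qed

section \<open>Programs for the weights\<close>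

abbreviation V :: "vname \<Rightarrow> iexp" where
  "V x \<equiv> IVar x []"

definition ieq :: "iexp \<Rightarrow> iexp \<Rightarrow> bexp" where
  "ieq a b = BConj (BNeg (ILess a b)) (BNeg (ILess b a))"

lemma bval_ieq [simp]: "bval s (ieq a b) \<longleftrightarrow> ival s a = ival s b"
  by (auto simp: ieq_def)

definition zero_acc :: prog where
  "zero_acc = PReal ''acc'' [] (ROfInt (IConst 0))"

lemma zero_acc_syntax [simp]:
  "int_writes zero_acc = {}" "real_writes zero_acc = {''acc''}" "loop_bounds zero_acc = {}" "proper zero_acc"
  by (simp_all add: zero_acc_def)

lemma sem_zero_acc [simp]: "sem zero_acc s = rupdate ''acc'' [] 0 s"
  by (simp add: zero_acc_def)

text \<open>Common to the quotient, update and product programs: \<open>f\<close> reads coefficient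
  \<open>u\<close> of one factor, \<open>g\<close> reads coefficient \<open>w - u\<close> of the
  other, and \<open>h\<close> is the value to store once \<open>acc\<close> holds the coefficient of
  the product.\<close>

definition conv_body :: "vname \<Rightarrow> iexp list \<Rightarrow> rexp \<Rightarrow> rexp \<Rightarrow> rexp \<Rightarrow> prog" where
  "conv_body y js f g h = PSeq zero_acc
     (PSeq (acc_loop ''u'' ''N'' (BNeg (ILess (V ''w'') (V ''u''))) (RMul f g))
       (PReal y js h))"

lemma conv_body_syntax [simp]:
  "int_writes (conv_body y js f g h) = {''u''}" "real_writes (conv_body y js f g h) = {''acc'', y}"
  "loop_bounds (conv_body y js f g h) = {''N''}" "proper (conv_body y js f g h)"
  by (auto simp: conv_body_def)

lemma sem_conv_body:
  assumes "ints s ''N'' [] = int D" "ints s ''w'' [] = int w" "w < D"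
    and F: "\<And>u. u \<le> w \<Longrightarrow> rval (iupdate ''u'' [] (int u) s) f = fps_nth F u"
    and G: "\<And>u. u \<le> w \<Longrightarrow> rval (iupdate ''u'' [] (int u) s) g = fps_nth G (w - u)"
    and acc: "\<And>r s. rval (rupdate ''acc'' [] r s) f = rval s f"
      "\<And>r s. rval (rupdate ''acc'' [] r s) g = rval s g"
  defines "s' \<equiv> rupdate ''acc'' [] (fps_nth (F * G) w) (iupdate ''u'' [] (int D) s)"
  shows "sem (conv_body y js f g h) s = rupdate y (map (ival s') js) (rval s' h) s'"
proof -
  have "(\<Sum>u<D. if bval (iupdate ''u'' [] (int u) (rupdate ''acc'' [] 0 s)) (BNeg (ILess (V ''w'') (V ''u'')))
        then rval (iupdate ''u'' [] (int u) (rupdate ''acc'' [] 0 s)) (RMul f g) else 0)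
     = fps_nth (F * G) w"
    unfolding fps_mult_nth_lessThan[OF \<open>w < D\<close>]
    by (intro sum.cong) (auto simp: assms(2) F G acc)
  then have "sem (acc_loop ''u'' ''N'' (BNeg (ILess (V ''w'') (V ''u''))) (RMul f g)) (rupdate ''acc'' [] 0 s) = s'"
    using assms(1) by (subst sem_acc_loop[where N = D]) (simp_all add: acc s'_def)
  then show ?thesis by (simp add: conv_body_def)
qed

section \<open>Elimination over truncated power series as a program\<close>

definition inverse_body :: prog where
  "inverse_body = PSeq zero_acc (PSeq
     (acc_loop ''u'' ''N'' (ILess (V ''u'') (V ''w''))
       (RMul (RVar ''E'' [V ''k'', V ''k'', V ''k'', ISub (V ''w'') (V ''u'')]) (RVar ''R'' [V ''u''])))
     (PCond (ILess (V ''w'') (IConst 1)) (PReal ''R'' [V ''w''] (ROfInt (IConst 1)))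
       (PReal ''R'' [V ''w''] (RSub (ROfInt (IConst 0)) (RVar ''acc'' [])))))"

lemma inverse_body_syntax [simp]:
  "int_writes inverse_body = {''u''}" "real_writes inverse_body = {''acc'', ''R''}"
  "loop_bounds inverse_body = {''N''}" "proper inverse_body"
  by (auto simp: inverse_body_def)

definition inverse_prog :: prog where
  "inverse_prog = PFor ''w'' ''N'' inverse_body"

lemma inverse_prog_syntax [simp]:
  "int_writes inverse_prog = {''w'', ''u''}" "real_writes inverse_prog = {''acc'', ''R''}"
  "loop_bounds inverse_prog = {''N''}" "proper inverse_prog"
  by (auto simp: inverse_prog_def)

text \<open>The body reads cells of \<open>R\<close> written by earlier rounds of the same loop,
  about which \<open>nest_fill\<close> lets it assume nothing. So the invariant tracks the initial
  segment of \<open>R\<close> that is already correct; the guard \<open>u < w\<close> keeps older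
  contents of \<open>R\<close> out of the sum.\<close>

lemma sem_inverse_prog:
  assumes N: "ints s ''N'' [] = int D" and k: "ints s ''k'' [] = int k"
    and E: "\<And>w. w < D \<Longrightarrow> reals s ''E'' [int k, int k, int k, int w] = fps_nth F w"
    and F0: "fps_nth F 0 = 1"
  shows "w < D \<Longrightarrow> reals (sem inverse_prog s) ''R'' [int w] = fps_nth (inverse F) w"
proof -
  define I where "I n s' \<longleftrightarrow> agree {''w'', ''u''} {''acc'', ''R''} s s' \<and>
    (\<forall>v<n. reals s' ''R'' [int v] = fps_nth (inverse F) v)" for n :: nat and s'
  have "I D (sem inverse_prog s)"
    unfolding inverse_prog_def
  proof (rule sem_PFor[OF _ N])
    fix n s' assume n: "n < D" and I: "I n s'" and w: "ints s' ''w'' [] = int n" and N': "ints s' ''N'' [] = int D"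
    have ag: "ints s' ''k'' [] = int k" "reals s' ''E'' = reals s ''E''"
      using I k by (auto simp: I_def agree_def)
    define S where "S = (\<Sum>u<n. fps_nth F (n - u) * fps_nth (inverse F) u)"
    have sum: "(\<Sum>u<D. if u < n then reals s ''E'' [int k, int k, int k, int n - int u] * reals s' ''R'' [int u] else 0) = S"
      unfolding S_def
    proof (rule sum.mono_neutral_cong_right)
      fix u assume "u \<in> {..<n}"
      then have u: "u < n" by simp
      then have "reals s ''E'' [int k, int k, int k, int n - int u] = fps_nth F (n - u)"
        using E[of "n - u"] n by (simp add: of_nat_diff)
      then show "(if u < n then reals s ''E'' [int k, int k, int k, int n - int u] * reals s' ''R'' [int u] else 0)
        = fps_nth F (n - u) * fps_nth (inverse F) u"
        using u I by (simp add: I_def)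
    qed (use n in auto)
    have "sem (acc_loop ''u'' ''N'' (ILess (V ''u'') (V ''w''))
       (RMul (RVar ''E'' [V ''k'', V ''k'', V ''k'', ISub (V ''w'') (V ''u'')]) (RVar ''R'' [V ''u''])))
       (rupdate ''acc'' [] 0 s') = rupdate ''acc'' [] S (iupdate ''u'' [] (int D) s')"
      by (subst sem_acc_loop[where N = D]) (simp_all add: w ag N' sum cong: if_cong)
    then have sem: "sem inverse_body s' = rupdate ''R'' [int n] (if n = 0 then 1 else - S)
        (rupdate ''acc'' [] S (iupdate ''u'' [] (int D) s'))"
      by (simp add: inverse_body_def w)
    have "(if n = 0 then 1 else - S) = fps_nth (inverse F) n"
      unfolding S_def by (rule fps_inverse_nth_rec[OF F0, symmetric])
    then show "I (Suc n) (iupdate ''w'' [] (int (Suc n)) (sem inverse_body s'))"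
      using I unfolding I_def sem by (simp add: agree_def less_Suc_eq)
  qed (auto simp: I_def agree_def)
  then show "w < D \<Longrightarrow> reals (sem inverse_prog s) ''R'' [int w] = fps_nth (inverse F) w"
    by (simp add: I_def)
qed

definition quotient_body :: prog where
  "quotient_body = conv_body ''Q'' [V ''j'', V ''w'']
     (RVar ''E'' [V ''k'', V ''j'', V ''k'', V ''u'']) (RVar ''R'' [ISub (V ''w'') (V ''u'')]) (RVar ''acc'' [])"

lemma quotient_body_syntax [simp]:
  "int_writes quotient_body = {''u''}" "real_writes quotient_body = {''acc'', ''Q''}"
  "loop_bounds quotient_body = {''N''}" "proper quotient_body"
  by (auto simp: quotient_body_def)

definition quotient_prog :: prog where
  "quotient_prog = nest [(''j'', ''m''), (''w'', ''N'')] quotient_body"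

lemma quotient_prog_syntax [simp]:
  "int_writes quotient_prog = {''j'', ''w'', ''u''}" "real_writes quotient_prog = {''acc'', ''Q''}"
  "loop_bounds quotient_prog = {''m'', ''N''}" "proper quotient_prog"
  by (auto simp: quotient_prog_def)

lemma sem_quotient_prog:
  assumes m: "ints s ''m'' [] = int m" and N: "ints s ''N'' [] = int D" and k: "ints s ''k'' [] = int k"
    and E: "\<And>j w. j < m \<Longrightarrow> w < D \<Longrightarrow> reals s ''E'' [int k, int j, int k, int w] = fps_nth (F j) w"
    and R: "\<And>w. w < D \<Longrightarrow> reals s ''R'' [int w] = fps_nth G w"
  shows "j < m \<Longrightarrow> w < D \<Longrightarrow> reals (sem quotient_prog s) ''Q'' [int j, int w] = fps_nth (F j * G) w"
proof -
  assume "j < m" "w < D"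
  then have "reals (sem quotient_prog s) ''Q'' ([] @ [int j, int w]) = fps_nth (F j * G) w"
    unfolding quotient_prog_def
  proof (rule nest_fill2[OF _ _ m N, rotated -2])
    fix j w s' assume jw: "j < m" "w < D"
      and ag: "agree (int_writes (nest [(''j'', ''m''), (''w'', ''N'')] quotient_body)) (real_writes quotient_body) s s'"
      and vars: "ints s' ''j'' [] = int j" "ints s' ''w'' [] = int w"
    have ag': "ints s' ''k'' [] = int k" "ints s' ''N'' [] = int D" "reals s' ''E'' = reals s ''E''"
        "reals s' ''R'' = reals s ''R''"
      using ag k N by (auto simp: agree_def)
    show "reals (sem quotient_body s') ''Q'' = (reals s' ''Q'')([] @ [int j, int w] := fps_nth (F j * G) w)"
      unfolding quotient_body_def using jw
      by (subst sem_conv_body[where D = D and w = w and F = "F j" and G = G])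
         (auto simp: ag' vars E R simp flip: of_nat_diff)
  qed auto
  then show "reals (sem quotient_prog s) ''Q'' [int j, int w] = fps_nth (F j * G) w" by simp
qed

definition update_body :: prog where
  "update_body = conv_body ''E'' [IAdd (V ''k'') (IConst 1), V ''j'', V ''l'', V ''w'']
       (RVar ''Q'' [V ''j'', V ''u'']) (RVar ''E'' [V ''k'', V ''k'', V ''l'', ISub (V ''w'') (V ''u'')])
       (RSub (RVar ''E'' [V ''k'', V ''j'', V ''l'', V ''w'']) (RVar ''acc'' []))"

lemma update_body_syntax [simp]:
  "int_writes update_body = {''u''}" "real_writes update_body = {''acc'', ''E''}"
  "loop_bounds update_body = {''N''}" "proper update_body"
  by (auto simp: update_body_def)

definition update_prog :: prog where
  "update_prog = nest [(''j'', ''m''), (''l'', ''m''), (''w'', ''N'')]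
     update_body"

lemma update_prog_syntax [simp]:
  "int_writes update_prog = {''j'', ''l'', ''w'', ''u''}" "real_writes update_prog = {''acc'', ''E''}"
  "loop_bounds update_prog = {''m'', ''N''}" "proper update_prog"
  by (auto simp: update_prog_def)

text \<open>Layer \<open>k + 1\<close> of \<open>E\<close> is written while only layer
  \<open>k\<close> is read, so the order in which the entries are updated is irrelevant.\<close>

lemma sem_update_prog:
  assumes m: "ints s ''m'' [] = int m" and N: "ints s ''N'' [] = int D" and k: "ints s ''k'' [] = int k"
    and "k < m"
    and E: "\<And>j l w. j < m \<Longrightarrow> l < m \<Longrightarrow> w < D \<Longrightarrow> reals s ''E'' [int k, int j, int l, int w] = fps_nth (X j l) w"
    and Q: "\<And>j w. j < m \<Longrightarrow> w < D \<Longrightarrow> reals s ''Q'' [int j, int w] = fps_nth (Y j) w"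
  shows "j < m \<Longrightarrow> l < m \<Longrightarrow> w < D \<Longrightarrow>
      reals (sem update_prog s) ''E'' [int (Suc k), int j, int l, int w] = fps_nth (X j l - Y j * X k l) w"
proof -
  assume "j < m" "l < m" "w < D"
  then have "reals (sem update_prog s) ''E'' ([int k + 1] @ [int j, int l, int w]) = fps_nth (X j l - Y j * X k l) w"
    unfolding update_prog_def
  proof (rule nest_fill3[OF _ _ m m N, rotated -3])
    fix j l w s' assume jlw: "j < m" "l < m" "w < D"
      and ag: "agree (int_writes (nest [(''j'', ''m''), (''l'', ''m''), (''w'', ''N'')] update_body))
       (real_writes update_body) s s'"
      and vars: "ints s' ''j'' [] = int j" "ints s' ''l'' [] = int l" "ints s' ''w'' [] = int w"
      and out: "\<forall>is. (\<forall>k'<m. \<forall>l<m. \<forall>q<D. is \<noteq> [int k + 1] @ [int k', int l, int q]) \<longrightarrow>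
        reals s' ''E'' is = reals s ''E'' is"
    have old: "reals s' ''E'' (int k # is) = reals s ''E'' (int k # is)" for "is"
      using out by simp
    have ag': "ints s' ''k'' [] = int k" "ints s' ''N'' [] = int D" "reals s' ''Q'' = reals s ''Q''"
      using ag k N by (auto simp: agree_def)
    show "reals (sem update_body s') ''E''
      = (reals s' ''E'')([int k + 1] @ [int j, int l, int w] := fps_nth (X j l - Y j * X k l) w)"
      using jlw \<open>k < m\<close>
      unfolding update_body_def by (subst sem_conv_body[where D = D and w = w and F = "Y j" and G = "X k l"])
         (auto simp: ag' vars old E Q simp flip: of_nat_diff)
  qed auto
  then show "reals (sem update_prog s) ''E'' [int (Suc k), int j, int l, int w] = fps_nth (X j l - Y j * X k l) w"
    by (simp add: add.commute)
qed

definition product_body :: prog where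
  "product_body = conv_body ''P'' [IAdd (V ''k'') (IConst 1), V ''w'']
       (RVar ''P'' [V ''k'', V ''u'']) (RVar ''E'' [V ''k'', V ''k'', V ''k'', ISub (V ''w'') (V ''u'')])
       (RVar ''acc'' [])"

lemma product_body_syntax [simp]:
  "int_writes product_body = {''u''}" "real_writes product_body = {''acc'', ''P''}"
  "loop_bounds product_body = {''N''}" "proper product_body"
  by (auto simp: product_body_def)

definition product_prog :: prog where
  "product_prog = nest [(''w'', ''N'')]
     product_body"

lemma product_prog_syntax [simp]:
  "int_writes product_prog = {''w'', ''u''}" "real_writes product_prog = {''acc'', ''P''}"
  "loop_bounds product_prog = {''N''}" "proper product_prog"
  by (auto simp: product_prog_def)

lemma sem_product_prog:
  assumes N: "ints s ''N'' [] = int D" and k: "ints s ''k'' [] = int k"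
    and P: "\<And>w. w < D \<Longrightarrow> reals s ''P'' [int k, int w] = fps_nth F w"
    and E: "\<And>w. w < D \<Longrightarrow> reals s ''E'' [int k, int k, int k, int w] = fps_nth G w"
  shows "w < D \<Longrightarrow> reals (sem product_prog s) ''P'' [int (Suc k), int w] = fps_nth (F * G) w"
proof -
  assume "w < D"
  then have "reals (sem product_prog s) ''P'' ([int k + 1] @ [int w]) = fps_nth (F * G) w"
    unfolding product_prog_def
  proof (rule nest_fill1[OF _ _ N, rotated -1])
    fix w s' assume w: "w < D"
      and ag: "agree (int_writes (nest [(''w'', ''N'')] product_body)) (real_writes product_body) s s'"
      and vars: "ints s' ''w'' [] = int w"
      and out: "\<forall>is. (\<forall>q<D. is \<noteq> [int k + 1] @ [int q]) \<longrightarrow> reals s' ''P'' is = reals s ''P'' is"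
    have old: "reals s' ''P'' (int k # is) = reals s ''P'' (int k # is)" for "is"
      using out by simp
    have ag': "ints s' ''k'' [] = int k" "ints s' ''N'' [] = int D" "reals s' ''E'' = reals s ''E''"
      using ag k N by (auto simp: agree_def)
    show "reals (sem product_body s') ''P'' = (reals s' ''P'')([int k + 1] @ [int w] := fps_nth (F * G) w)"
      using w
      unfolding product_body_def by (subst sem_conv_body[where D = D and w = w and F = F and G = G])
         (auto simp: ag' vars old E P simp flip: of_nat_diff)
  qed auto
  then show "reals (sem product_prog s) ''P'' [int (Suc k), int w] = fps_nth (F * G) w"
    by (simp add: add.commute)
qed

text \<open>
  \<open>E[k,j,l,w]\<close> holds the \<open>w\<close>-th coefficient of the \<open>(j,l)\<close> entry after \<open>k\<close> elimination steps,
  \<open>R[w]\<close> that of the inverse of the current pivot, \<open>Q[j,w]\<close> that of the multiplier of row \<open>j\<close>, and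
  \<open>P[k,w]\<close> that of the product of the first \<open>k\<close> pivots.
\<close>

definition elim_prog :: prog where
  "elim_prog = PFor ''k'' ''m'' (PSeq inverse_prog (PSeq quotient_prog (PSeq product_prog update_prog)))"

lemma elim_prog_syntax [simp]:
  "int_writes elim_prog = {''k'', ''j'', ''l'', ''w'', ''u''}"
  "real_writes elim_prog = {''acc'', ''R'', ''Q'', ''E'', ''P''}"
  "loop_bounds elim_prog = {''m'', ''N''}" "proper elim_prog"
  by (auto simp: elim_prog_def)

text \<open>The invariant compares only coefficients below \<open>D\<close>. This is self-contained,
  since each series operation obtains these from coefficients below \<open>D\<close> of its
  arguments.\<close>

lemma sem_elim_prog:
  assumes m: "ints s ''m'' [] = int m" and N: "ints s ''N'' [] = int D"
    and E: "\<And>j l w. j < m \<Longrightarrow> l < m \<Longrightarrow> w < D \<Longrightarrow> reals s ''E'' [0, int j, int l, int w] = fps_nth (X j l) w"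
    and P: "\<And>w. w < D \<Longrightarrow> reals s ''P'' [0, int w] = fps_nth 1 w"
    and X: "\<And>j l. j < m \<Longrightarrow> l < m \<Longrightarrow> fps_nth (X j l) 0 = (if j = l then 1 else 0)"
  shows "w < D \<Longrightarrow> reals (sem elim_prog s) ''P'' [int m, int w] = fps_nth (\<Prod>k<m. elim X k k k) w"
proof -
  define I where "I k s' \<longleftrightarrow> agree {''k'', ''j'', ''l'', ''w'', ''u''} {''acc'', ''R'', ''Q'', ''E'', ''P''} s s' \<and>
    (\<forall>j<m. \<forall>l<m. \<forall>w<D. reals s' ''E'' [int k, int j, int l, int w] = fps_nth (elim X k j l) w) \<and>
    (\<forall>w<D. reals s' ''P'' [int k, int w] = fps_nth (\<Prod>q<k. elim X q q q) w)" for k s'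
  have "I m (sem elim_prog s)"
    unfolding elim_prog_def
  proof (rule sem_PFor[OF _ m])
    show "I 0 (iupdate ''k'' [] 0 s)" using E P by (auto simp: I_def agree_def)
    fix k s' assume k: "k < m" and I: "I k s'" and k': "ints s' ''k'' [] = int k"
    let ?s1 = "sem inverse_prog s'" and ?p = "elim X k k k"
    let ?s2 = "sem quotient_prog ?s1"
    let ?s3 = "sem product_prog ?s2"
    let ?s4 = "sem update_prog ?s3"
    note frame = ints_sem_notin reals_sem_notin
    have m': "ints s' ''m'' [] = int m" and N': "ints s' ''N'' [] = int D"
      using I m N by (simp_all add: I_def agree_def)
    have E': "reals s' ''E'' [int k, int j, int l, int w] = fps_nth (elim X k j l) w"
      if "j < m" "l < m" "w < D" for j l w using I that by (simp add: I_def)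
    have P': "reals s' ''P'' [int k, int w] = fps_nth (\<Prod>q<k. elim X q q q) w" if "w < D" for w
      using I that by (simp add: I_def)
    have R: "reals ?s1 ''R'' [int w] = fps_nth (inverse ?p) w" if "w < D" for w
      using sem_inverse_prog[OF N' k', of ?p w] elim_const_coeff[of m X k k k] X k E' that by simp
    have Q: "reals ?s2 ''Q'' [int j, int w] = fps_nth (elim X k j k * inverse ?p) w" if "j < m" "w < D" for j w
      using sem_quotient_prog[of ?s1 m D k "\<lambda>j. elim X k j k" "inverse ?p" j w] m' N' k' E' R k that
      by (simp add: frame)
    have P4: "reals ?s3 ''P'' [int (Suc k), int w] = fps_nth (\<Prod>q<Suc k. elim X q q q) w" if "w < D" for w
      using sem_product_prog[of ?s2 D k "\<Prod>q<k. elim X q q q" ?p w] N' k' P' E' k that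
      by (simp add: frame)
    have E4: "reals ?s4 ''E'' [int (Suc k), int j, int l, int w] = fps_nth (elim X (Suc k) j l) w"
      if "j < m" "l < m" "w < D" for j l w
      using sem_update_prog[of ?s3 m D k "elim X k" "\<lambda>j. elim X k j k * inverse ?p" j l w] m' N' k' E' Q k that
      by (simp add: frame)
    have "agree {''k'', ''j'', ''l'', ''w'', ''u''} {''acc'', ''R'', ''Q'', ''E'', ''P''} s
        (iupdate ''k'' [] (int (Suc k)) ?s4)"
      using I by (simp add: I_def agree_def frame)
    then show "I (Suc k) (iupdate ''k'' [] (int (Suc k))
        (sem (PSeq inverse_prog (PSeq quotient_prog (PSeq product_prog update_prog))) s'))"
      using E4 P4 unfolding I_def by (simp add: frame del: of_nat_Suc)
  qed auto
  then show "w < D \<Longrightarrow> reals (sem elim_prog s) ''P'' [int m, int w] = fps_nth (\<Prod>k<m. elim X k k k) w"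
    by (simp add: I_def)
qed

text \<open>The input together with derived constants. They are kept in variables because a loop
  bound has to be one; \<open>two\<close> bounds the loop over the two choices for an
  element.\<close>

definition env :: "real mat \<Rightarrow> int vec \<Rightarrow> int \<Rightarrow> store \<Rightarrow> bool" where
  "env L c C s \<longleftrightarrow> ints s ''m'' [] = int (dim_vec c) \<and> ints s ''M'' [] = int (dim_vec c + 1) \<and>
     ints s ''N'' [] = int (degree_bound c) \<and> ints s ''K'' [] = radix c \<and>
     ints s ''n'' [] = int (norm1 c) \<and> ints s ''C'' [] = C \<and> ints s ''two'' [] = int 2 \<and>
     (\<forall>j<dim_vec c. ints s ''c'' [int j] = vec_index c j) \<and>
     (\<forall>j<dim_vec c. \<forall>l<dim_vec c. reals s ''L'' [int j, int l] = L $$ (j, l))"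

lemma env_agree:
  assumes "agree X Y s s'" "X \<inter> {''m'', ''M'', ''N'', ''K'', ''n'', ''C'', ''two'', ''c''} = {}" "''L'' \<notin> Y"
    and "env L c C s"
  shows "env L c C s'"
  using assms by (simp add: env_def agree_def)

lemma envD:
  assumes "env L c C s"
  shows "ints s ''m'' [] = int (dim_vec c)" "ints s ''M'' [] = int (dim_vec c + 1)"
    "ints s ''N'' [] = int (degree_bound c)" "ints s ''K'' [] = radix c"
    "ints s ''n'' [] = int (norm1 c)" "ints s ''C'' [] = C" "ints s ''two'' [] = int 2"
    "j < dim_vec c \<Longrightarrow> ints s ''c'' [int j] = vec_index c j"
    "j < dim_vec c \<Longrightarrow> l < dim_vec c \<Longrightarrow> reals s ''L'' [int j, int l] = L $$ (j, l)"
  using assms by (auto simp: env_def)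

section \<open>From the partial choice to the matrix, and from the determinant to the weight\<close>

definition count_prog :: prog where
  "count_prog = PSeq (PInt ''a'' [] (IConst 0)) (PFor ''j'' ''m''
     (PCond (ILess (V ''i'') (V ''j'')) PSkip
       (PInt ''a'' [] (IAdd (V ''a'') (IVar ''S'' [V ''j''])))))"

lemma count_prog_syntax [simp]:
  "int_writes count_prog = {''a'', ''j''}" "real_writes count_prog = {}"
  "loop_bounds count_prog = {''m''}" "proper count_prog"
  by (auto simp: count_prog_def)

text \<open>Element \<open>i\<close> is included because it has been decided tentatively. The guard
  skips the entries of \<open>S\<close> beyond \<open>i\<close>, so nothing has to be known about
  them.\<close>

lemma sem_count_prog:
  assumes m: "ints s ''m'' [] = int m" and i: "ints s ''i'' [] = int i" "i < m"
    and A: "A \<subseteq> {..i}" "\<And>j. j \<le> i \<Longrightarrow> ints s ''S'' [int j] = of_bool (j \<in> A)"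
  shows "ints (sem count_prog s) ''a'' [] = int (card A)"
proof -
  define I where "I n s' \<longleftrightarrow> agree {''a'', ''j''} {} s s' \<and> ints s' ''a'' [] = int (card (A \<inter> {..<n}))"
    for n :: nat and s'
  have "I m (sem (PFor ''j'' ''m'' (PCond (ILess (V ''i'') (V ''j'')) PSkip
       (PInt ''a'' [] (IAdd (V ''a'') (IVar ''S'' [V ''j'']))))) (iupdate ''a'' [] 0 s))"
  proof (rule sem_PFor)
    fix n s' assume "n < m" and I: "I n s'" and j: "ints s' ''j'' [] = int n"
    have ag: "ints s' ''i'' [] = int i" "ints s' ''S'' = ints s ''S''"
      using I i by (auto simp: I_def agree_def)
    have "int (card (A \<inter> {..<Suc n})) = int (card (A \<inter> {..<n})) + of_bool (n \<in> A)"
      by (simp add: lessThan_Suc)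
    moreover have "i < n \<Longrightarrow> n \<notin> A" using A(1) by auto
    ultimately have card: "int (card (A \<inter> {..<Suc n})) = int (card (A \<inter> {..<n})) + (if i < n then 0 else of_bool (n \<in> A))"
      by simp
    show "I (Suc n) (iupdate ''j'' [] (int (Suc n)) (sem (PCond (ILess (V ''i'') (V ''j'')) PSkip
       (PInt ''a'' [] (IAdd (V ''a'') (IVar ''S'' [V ''j''])))) s'))"
    proof (cases "i < n")
      case True
      then show ?thesis using I card i(1) by (simp add: I_def agree_def j ag)
    next
      case False
      then show ?thesis using I card i(1) A(2)[of n] by (simp add: I_def agree_def j ag)
    qed
  qed (use m in \<open>auto simp: I_def agree_def\<close>)
  moreover have "A \<inter> {..<m} = A" using A(1) i(2) by auto
  ultimately show ?thesis by (simp add: count_prog_def I_def)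
qed

definition set_acc_if :: "bexp \<Rightarrow> rexp \<Rightarrow> prog" where
  "set_acc_if b e = PCond b (PReal ''acc'' [] e) PSkip"

lemma set_acc_if_syntax [simp]:
  "int_writes (set_acc_if b e) = {}" "real_writes (set_acc_if b e) = {''acc''}"
  "loop_bounds (set_acc_if b e) = {}" "proper (set_acc_if b e)"
  by (simp_all add: set_acc_if_def)

lemma sem_set_acc_if [simp]:
  "sem (set_acc_if b e) s = rupdate ''acc'' [] (if bval s b then rval s e else reals s ''acc'' []) s"
  by (simp add: set_acc_if_def rupdate_same)

definition entry_body :: prog where
  "entry_body = PSeq zero_acc
    (PSeq (set_acc_if (BConj (ieq (V ''j'') (V ''l'')) (ieq (V ''w'') (IConst 0)))
      (ROfInt (IConst 1)))
    (PSeq (set_acc_if (BConj (ILess (V ''i'') (V ''j'')) (ieq (V ''w'') (IAdd (IVar ''c'' [V ''j'']) (V ''K''))))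
      (RVar ''L'' [V ''j'', V ''l'']))
    (PSeq (set_acc_if (BConj (BNeg (ILess (V ''i'') (V ''j''))) (BConj (ILess (IConst 0) (IVar ''S'' [V ''j'']))
        (ieq (V ''w'') (IAdd (IVar ''c'' [V ''j'']) (IMul (V ''K'') (V ''M''))))))
      (RVar ''L'' [V ''j'', V ''l'']))
    (PReal ''E'' [IConst 0, V ''j'', V ''l'', V ''w''] (RVar ''acc'' [])))))"

definition entry_prog :: prog where
  "entry_prog = nest [(''j'', ''m''), (''l'', ''m''), (''w'', ''N'')] entry_body"

lemma entry_body_syntax [simp]:
  "int_writes entry_body = {}" "real_writes entry_body = {''acc'', ''E''}"
  "loop_bounds entry_body = {}" "proper entry_body"
  by (auto simp: entry_body_def)

lemma entry_prog_syntax [simp]: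
  "int_writes entry_prog = {''j'', ''l'', ''w''}" "real_writes entry_prog = {''acc'', ''E''}"
  "loop_bounds entry_prog = {''m'', ''N''}" "proper entry_prog"
  by (auto simp: entry_prog_def)

text \<open>The index is \<open>Suc i\<close> because \<open>i\<close> counts as decided. A decided
  element outside \<open>A\<close> passes neither test on exponents, which leaves a row of the
  identity.\<close>

lemma sem_entry_prog:
  assumes env: "env L c C s" and i: "ints s ''i'' [] = int i"
    and S: "\<And>j. j \<le> i \<Longrightarrow> ints s ''S'' [int j] = of_bool (j \<in> A)"
  shows "j < dim_vec c \<Longrightarrow> l < dim_vec c \<Longrightarrow> w < degree_bound c \<Longrightarrow>
    reals (sem entry_prog s) ''E'' [0, int j, int l, int w] = fps_nth (marked_entry L c A (Suc i) j l) w"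
proof -
  assume "j < dim_vec c" "l < dim_vec c" "w < degree_bound c"
  then have "reals (sem entry_prog s) ''E'' ([0] @ [int j, int l, int w])
      = fps_nth (marked_entry L c A (Suc i) j l) w"
    unfolding entry_prog_def
  proof (rule nest_fill3[OF _ _ envD(1)[OF env] envD(1)[OF env] envD(3)[OF env], rotated -3])
    fix j l w s' assume jlw: "j < dim_vec c" "l < dim_vec c" "w < degree_bound c"
      and ag: "agree (int_writes (nest [(''j'', ''m''), (''l'', ''m''), (''w'', ''N'')] entry_body))
        (real_writes entry_body) s s'"
      and vars: "ints s' ''j'' [] = int j" "ints s' ''l'' [] = int l" "ints s' ''w'' [] = int w"
    have env': "env L c C s'" by (rule env_agree[OF ag _ _ env]) auto
    have ag': "ints s' ''i'' [] = int i" "ints s' ''S'' = ints s ''S''"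
      using ag i by (auto simp: agree_def)
    have "reals (sem entry_body s') ''E'' = (reals s' ''E'')([0, int j, int l, int w] :=
      (if i < j \<and> int w = vec_index c j + radix c
         \<or> \<not> i < j \<and> 0 < ints s ''S'' [int j] \<and> int w = vec_index c j + radix c * int (dim_vec c + 1)
       then L $$ (j, l) else if j = l \<and> w = 0 then 1 else 0))"
      by (auto simp: entry_body_def vars ag' envD(2,4)[OF env'] envD(8,9)[OF env'] jlw)
    also have "(if i < j \<and> int w = vec_index c j + radix c
         \<or> \<not> i < j \<and> 0 < ints s ''S'' [int j] \<and> int w = vec_index c j + radix c * int (dim_vec c + 1)
       then L $$ (j, l) else if j = l \<and> w = 0 then 1 else 0)
       = fps_nth (marked_entry L c A (Suc i) j l) w"
      unfolding marked_entry_nth[OF jlw(1)] exponent_def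
      by (cases "i < j") (auto simp: S Suc_le_eq add.commute[of 1])
    finally show "reals (sem entry_body s') ''E'' = (reals s' ''E'')([0] @ [int j, int l, int w] :=
        fps_nth (marked_entry L c A (Suc i) j l) w)" by (simp only: append.simps)
  qed auto
  then show "reals (sem entry_prog s) ''E'' [0, int j, int l, int w]
      = fps_nth (marked_entry L c A (Suc i) j l) w" by simp
qed

definition one_body :: prog where
  "one_body = PSeq zero_acc
    (PSeq (set_acc_if (ieq (V ''w'') (IConst 0)) (ROfInt (IConst 1)))
    (PReal ''P'' [IConst 0, V ''w''] (RVar ''acc'' [])))"

definition one_prog :: prog where
  "one_prog = nest [(''w'', ''N'')] one_body"

lemma one_body_syntax [simp]:
  "int_writes one_body = {}" "real_writes one_body = {''acc'', ''P''}"
  "loop_bounds one_body = {}" "proper one_body"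
  by (auto simp: one_body_def)

lemma one_prog_syntax [simp]:
  "int_writes one_prog = {''w''}" "real_writes one_prog = {''acc'', ''P''}"
  "loop_bounds one_prog = {''N''}" "proper one_prog"
  by (auto simp: one_prog_def)

lemma sem_one_prog:
  assumes N: "ints s ''N'' [] = int D"
  shows "w < D \<Longrightarrow> reals (sem one_prog s) ''P'' [0, int w] = fps_nth 1 w"
proof -
  assume "w < D"
  then have "reals (sem one_prog s) ''P'' ([0] @ [int w]) = fps_nth 1 w"
    unfolding one_prog_def
    by (rule nest_fill1[OF _ _ N, rotated -1]) (auto simp: one_body_def)
  then show "reals (sem one_prog s) ''P'' [0, int w] = fps_nth 1 w" by simp
qed

text \<open>The number \<open>x\<close> of \<open>exponent_decode\<close>: the exponent minus the
  contribution of \<open>card A\<close> decided and \<open>g\<close> undecided elements.\<close>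

definition offset :: iexp where
  "offset = ISub (V ''w'') (IMul (V ''K'') (IAdd (IMul (V ''M'') (V ''a'')) (V ''g'')))"

definition range_cond :: bexp where
  "range_cond = BConj (BNeg (ILess offset (ISub (IConst 0) (V ''n''))))
    (BConj (BNeg (ILess (V ''n'') offset)) (BNeg (ILess (V ''C'') offset)))"

definition range_body :: prog where
  "range_body = PSeq zero_acc (PSeq (acc_loop ''w'' ''N'' range_cond (RVar ''P'' [V ''m'', V ''w'']))
     (PReal ''G'' [V ''g''] (RVar ''acc'' [])))"

definition range_prog :: prog where
  "range_prog = nest [(''g'', ''M'')] range_body"

lemma range_body_syntax [simp]:
  "int_writes range_body = {''w''}" "real_writes range_body = {''acc'', ''G''}"
  "loop_bounds range_body = {''N''}" "proper range_body"
  by (auto simp: range_body_def)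

lemma range_prog_syntax [simp]:
  "int_writes range_prog = {''g'', ''w''}" "real_writes range_prog = {''acc'', ''G''}"
  "loop_bounds range_prog = {''M'', ''N''}" "proper range_prog"
  by (auto simp: range_prog_def)

lemma sem_range_prog:
  assumes env: "env L c C s" and a: "ints s ''a'' [] = int a"
    and P: "\<And>w. w < degree_bound c \<Longrightarrow> reals s ''P'' [int (dim_vec c), int w] = fps_nth F w"
  shows "g < dim_vec c + 1 \<Longrightarrow> reals (sem range_prog s) ''G'' [int g] = (\<Sum>w<degree_bound c.
    let x = int w - radix c * ((int (dim_vec c) + 1) * int a + int g) in
    if - int (norm1 c) \<le> x \<and> x \<le> int (norm1 c) \<and> x \<le> C then fps_nth F w else 0)"
proof -
  define f where "f g = (\<Sum>w<degree_bound c.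
    let x = int w - radix c * ((int (dim_vec c) + 1) * int a + int g) in
    if - int (norm1 c) \<le> x \<and> x \<le> int (norm1 c) \<and> x \<le> C then fps_nth F w else 0)" for g
  assume "g < dim_vec c + 1"
  then have "reals (sem range_prog s) ''G'' ([] @ [int g]) = f g"
    unfolding range_prog_def
  proof (rule nest_fill1[OF _ _ envD(2)[OF env], rotated -1])
    fix g s'
    assume ag: "agree (int_writes (nest [(''g'', ''M'')] range_body)) (real_writes range_body) s s'"
      and g: "ints s' ''g'' [] = int g"
    have env': "env L c C s'" by (rule env_agree[OF ag _ _ env]) auto
    have ag': "ints s' ''a'' [] = int a" "reals s' ''P'' = reals s ''P''"
      using ag a by (auto simp: agree_def)
    have "sem (acc_loop ''w'' ''N'' range_cond (RVar ''P'' [V ''m'', V ''w''])) (rupdate ''acc'' [] 0 s')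
      = rupdate ''acc'' [] (f g) (iupdate ''w'' [] (int (degree_bound c)) s')"
    proof (subst sem_acc_loop[where N = "degree_bound c"])
      have "(\<Sum>k<degree_bound c. if bval (iupdate ''w'' [] (int k) (rupdate ''acc'' [] 0 s')) range_cond
          then rval (iupdate ''w'' [] (int k) (rupdate ''acc'' [] 0 s')) (RVar ''P'' [V ''m'', V ''w'']) else 0) = f g"
        unfolding f_def Let_def
        by (intro sum.cong if_cong)
           (auto simp: range_cond_def offset_def envD(1-6)[OF env'] g ag' P not_less algebra_simps)
      then show "rupdate ''acc'' [] (reals (rupdate ''acc'' [] 0 s') ''acc'' [] +
        (\<Sum>k<degree_bound c. if bval (iupdate ''w'' [] (int k) (rupdate ''acc'' [] 0 s')) range_cond
          then rval (iupdate ''w'' [] (int k) (rupdate ''acc'' [] 0 s')) (RVar ''P'' [V ''m'', V ''w'']) else 0))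
        (iupdate ''w'' [] (int (degree_bound c)) (rupdate ''acc'' [] 0 s'))
        = rupdate ''acc'' [] (f g) (iupdate ''w'' [] (int (degree_bound c)) s')" by simp
    qed (simp_all add: range_cond_def offset_def envD(3)[OF env'])
    then show "reals (sem range_body s') ''G'' = (reals s' ''G'')([] @ [int g] := f g)"
      by (simp add: range_body_def g)
  qed auto
  then show "reals (sem range_prog s) ''G'' [int g] = (\<Sum>w<degree_bound c.
    let x = int w - radix c * ((int (dim_vec c) + 1) * int a + int g) in
    if - int (norm1 c) \<le> x \<and> x \<le> int (norm1 c) \<and> x \<le> C then fps_nth F w else 0)"
    by (simp add: f_def)
qed

definition total_prog :: prog where
  "total_prog = PSeq zero_acc (PSeq (acc_loop ''g'' ''M'' (ILess (IConst 0) (IConst 1)) (RVar ''G'' [V ''g'']))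
     (PReal ''W'' [V ''v''] (RVar ''acc'' [])))"

lemma total_prog_syntax [simp]:
  "int_writes total_prog = {''g''}" "real_writes total_prog = {''acc'', ''W''}"
  "loop_bounds total_prog = {''M''}" "proper total_prog"
  by (auto simp: total_prog_def)

lemma sem_total_prog:
  assumes M: "ints s ''M'' [] = int M"
  shows "reals (sem total_prog s) ''W'' =
    (reals s ''W'')([ints s ''v'' []] := (\<Sum>g<M. reals s ''G'' [int g]))"
proof -
  have "sem (acc_loop ''g'' ''M'' (ILess (IConst 0) (IConst 1)) (RVar ''G'' [V ''g''])) (rupdate ''acc'' [] 0 s)
    = rupdate ''acc'' [] (\<Sum>g<M. reals s ''G'' [int g]) (iupdate ''g'' [] (int M) s)"
    by (subst sem_acc_loop[where N = M]) (simp_all add: M)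
  then show ?thesis by (simp add: total_prog_def)
qed

definition weight_prog :: prog where
  "weight_prog = PSeq count_prog (PSeq entry_prog (PSeq one_prog (PSeq elim_prog (PSeq range_prog total_prog))))"

lemma weight_prog_syntax [simp]:
  "int_writes weight_prog = {''a'', ''j'', ''l'', ''w'', ''u'', ''k'', ''g''}"
  "real_writes weight_prog = {''acc'', ''E'', ''P'', ''R'', ''Q'', ''G'', ''W''}"
  "loop_bounds weight_prog = {''m'', ''M'', ''N''}" "proper weight_prog"
  by (auto simp: weight_prog_def)

text \<open>Only the cell of \<open>W\<close> selected by \<open>v\<close> changes, so the weight of
  the other choice survives.\<close>

lemma sem_weight_prog:
  assumes L: "L \<in> carrier_mat (dim_vec c) (dim_vec c)"
    and env: "env L c C s" and i: "ints s ''i'' [] = int i" "i < dim_vec c"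
    and A: "A \<subseteq> {..i}" "\<And>j. j \<le> i \<Longrightarrow> ints s ''S'' [int j] = of_bool (j \<in> A)"
  shows "reals (sem weight_prog s) ''W'' = (reals s ''W'')([ints s ''v'' []] := weight L c C A (Suc i))"
proof -
  let ?s1 = "sem count_prog s"
  let ?s2 = "sem entry_prog ?s1"
  let ?s3 = "sem one_prog ?s2"
  let ?s4 = "sem elim_prog ?s3"
  let ?s5 = "sem range_prog ?s4"
  note frame = ints_sem_notin reals_sem_notin
  have fin: "finite A" using A(1) finite_subset by blast
  have env1: "env L c C ?s1" by (rule env_agree[OF agree_sem _ _ env]) auto
  have env2: "env L c C ?s2" by (rule env_agree[OF agree_sem _ _ env1]) auto
  have env3: "env L c C ?s3" by (rule env_agree[OF agree_sem _ _ env2]) auto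
  have env4: "env L c C ?s4" by (rule env_agree[OF agree_sem _ _ env3]) auto
  have env5: "env L c C ?s5" by (rule env_agree[OF agree_sem _ _ env4]) auto
  have a: "ints ?s1 ''a'' [] = int (card A)"
    by (rule sem_count_prog[OF envD(1)[OF env] i A])
  have E: "reals ?s2 ''E'' [0, int j, int l, int w] = fps_nth (marked_entry L c A (Suc i) j l) w"
    if "j < dim_vec c" "l < dim_vec c" "w < degree_bound c" for j l w
    using sem_entry_prog[OF env1 _ _ that, of i A] i A(2) by (simp add: frame)
  have P: "reals ?s4 ''P'' [int (dim_vec c), int w] = fps_nth (marked_det L c A (Suc i)) w"
    if "w < degree_bound c" for w
    unfolding marked_det_def
    using E by (intro sem_elim_prog[OF envD(1)[OF env3] envD(3)[OF env3]] marked_entry_const_coeff that sem_one_prog[OF envD(3)[OF env2]])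
      (simp_all add: frame)
  have "reals ?s5 ''G'' [int g] = (\<Sum>w<degree_bound c.
    let x = int w - radix c * ((int (dim_vec c) + 1) * int (card A) + int g) in
    if - int (norm1 c) \<le> x \<and> x \<le> int (norm1 c) \<and> x \<le> C then fps_nth (marked_det L c A (Suc i)) w else 0)"
    if "g < dim_vec c + 1" for g
    using that a P by (intro sem_range_prog[OF env4]) (simp_all add: frame)
  then have "(\<Sum>g<dim_vec c + 1. reals ?s5 ''G'' [int g]) = weight L c C A (Suc i)"
    unfolding weight_eq_coeff_sum[OF L fin] by (intro sum.cong) simp_all
  then show ?thesis
    by (simp only: weight_prog_def sem.simps sem_total_prog[OF envD(2)[OF env5]]) (simp add: frame)
qed

text \<open>
  The entry of \<open>S\<close> for the element to be decided is tentatively set to 0 and then to 1, so that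
  \<open>W\<close> receives the total weights of both choices.
\<close>

definition step_prog :: prog where
  "step_prog = PFor ''v'' ''two'' (PSeq (PInt ''S'' [V ''i''] (V ''v'')) weight_prog)"

lemma step_prog_syntax [simp]:
  "int_writes step_prog = {''v'', ''S'', ''a'', ''j'', ''l'', ''w'', ''u'', ''k'', ''g''}"
  "real_writes step_prog = {''acc'', ''E'', ''P'', ''R'', ''Q'', ''G'', ''W''}"
  "loop_bounds step_prog = {''two'', ''m'', ''M'', ''N''}" "proper step_prog"
  by (auto simp: step_prog_def)

text \<open>\<open>S\<close> is described below \<open>i\<close> only: its entry for
  \<open>i\<close> is left over from the second tentative choice until the toss overwrites
  it.\<close>

lemma sem_step_prog:
  assumes L: "L \<in> carrier_mat (dim_vec c) (dim_vec c)"
    and env: "env L c C s" and i: "ints s ''i'' [] = int i" "i < dim_vec c"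
    and A: "A \<subseteq> {..<i}" "\<And>j. j < i \<Longrightarrow> ints s ''S'' [int j] = of_bool (j \<in> A)"
  shows "env L c C (sem step_prog s)" "ints (sem step_prog s) ''i'' [] = int i"
    "\<And>j. j < i \<Longrightarrow> ints (sem step_prog s) ''S'' [int j] = of_bool (j \<in> A)"
    "reals (sem step_prog s) ''W'' [0] = weight L c C A (Suc i)"
    "reals (sem step_prog s) ''W'' [1] = weight L c C (insert i A) (Suc i)"
proof -
  define I where "I k s' \<longleftrightarrow> env L c C s' \<and> ints s' ''i'' [] = int i \<and>
     (\<forall>j<i. ints s' ''S'' [int j] = of_bool (j \<in> A)) \<and>
     (\<forall>k'<k. reals s' ''W'' [int k'] = weight L c C (if k' = 0 then A else insert i A) (Suc i))"
    for k :: nat and s'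
  have "I 2 (sem step_prog s)"
    unfolding step_prog_def
  proof (rule sem_PFor[OF _ envD(7)[OF env]])
    show "I 0 (iupdate ''v'' [] 0 s)" using env i A by (simp add: I_def env_def)
    fix k s' assume k: "k < 2" and I: "I k s'" and v: "ints s' ''v'' [] = int k"
    let ?A = "if k = 0 then A else insert i A"
    let ?s1 = "iupdate ''S'' [int i] (int k) s'"
    have env1: "env L c C ?s1" using I by (simp add: I_def env_def)
    have A': "?A \<subseteq> {..i}" using A(1) by auto
    have S: "ints ?s1 ''S'' [int j] = of_bool (j \<in> ?A)" if "j \<le> i" for j
      using that I k A(1) by (auto simp: I_def)
    have W: "reals (sem weight_prog ?s1) ''W'' = (reals s' ''W'')([int k] := weight L c C ?A (Suc i))"
      using sem_weight_prog[OF L env1 _ i(2) A' S] I v by (simp add: I_def)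
    have "env L c C (iupdate ''v'' [] (int (Suc k)) (sem weight_prog ?s1))"
      by (rule env_agree[of "insert ''v'' (int_writes weight_prog)" "real_writes weight_prog", OF _ _ _ env1])
         (auto simp: agree_iupdate intro: agree_mono[OF agree_sem])
    then have "I (Suc k) (iupdate ''v'' [] (int (Suc k)) (sem weight_prog ?s1))"
      using I W by (auto simp: I_def ints_sem_notin less_Suc_eq)
    then show "I (Suc k) (iupdate ''v'' [] (int (Suc k))
        (sem (PSeq (PInt ''S'' [V ''i''] (V ''v'')) weight_prog) s'))"
      using I v by (simp add: I_def)
  qed auto
  then show "env L c C (sem step_prog s)" "ints (sem step_prog s) ''i'' [] = int i"
    "\<And>j. j < i \<Longrightarrow> ints (sem step_prog s) ''S'' [int j] = of_bool (j \<in> A)"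
    "reals (sem step_prog s) ''W'' [0] = weight L c C A (Suc i)"
    "reals (sem step_prog s) ''W'' [1] = weight L c C (insert i A) (Suc i)"
    by (auto simp: I_def dest: spec[of _ 0] spec[of _ 1])
qed

section \<open>The sampling program\<close>

text \<open>A coupling of an abstract distribution with the stores that the program reaches. The law
  of the sampled set can thus be studied without stores, and the time bound holds for every
  outcome.\<close>

definition runs :: "com \<Rightarrow> store \<Rightarrow> nat \<Rightarrow> 'a pmf \<Rightarrow> ('a \<Rightarrow> store \<Rightarrow> bool) \<Rightarrow> bool" where
  "runs p s t \<mu> R \<longleftrightarrow> (\<exists>D. exec p s D \<and> rel_pmf (\<lambda>a (s', t'). R a s' \<and> t' \<le> t) \<mu> D)"

lemma runs_return:
  assumes "exec p s (return_pmf (s', t'))" "t' \<le> t" "R a s'"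
  shows "runs p s t (return_pmf a) R"
  using assms unfolding runs_def by (intro exI[of _ "return_pmf (s', t')"]) simp

text \<open>The execution rules want a continuation that depends on the store alone, whereas
  \<open>\<nu>\<close> depends on the abstract value. Any choice of an execution for each store will
  do: by \<open>exec_deterministic\<close> it is the one coupled with \<open>\<nu> a\<close> for
  every related \<open>a\<close>.\<close>

lemma runs_continue:
  assumes D: "rel_pmf (\<lambda>a (s', t'). R a s' \<and> t' \<le> t1) \<mu> D"
    and q: "\<And>a s'. a \<in> set_pmf \<mu> \<Longrightarrow> R a s' \<Longrightarrow> runs q s' t2 (\<nu> a) R'"
  shows "\<exists>K. (\<forall>s' t'. (s', t') \<in> set_pmf D \<longrightarrow> exec q s' (K s')) \<and>
    rel_pmf (\<lambda>a (s', t'). R' a s' \<and> t' \<le> t1 + t2) (bind_pmf \<mu> \<nu>) (and_then D K)"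
proof -
  define K where "K s' = (SOME D'. exec q s' D')" for s'
  have K: "exec q s' (K s')" "rel_pmf (\<lambda>a (s', t'). R' a s' \<and> t' \<le> t2) (\<nu> a) (K s')"
    if a: "a \<in> set_pmf \<mu>" and R: "R a s'" for a s'
  proof -
    obtain D' where D': "exec q s' D'" "rel_pmf (\<lambda>a (s', t'). R' a s' \<and> t' \<le> t2) (\<nu> a) D'"
      using q[OF a R] unfolding runs_def by blast
    then show "exec q s' (K s')" unfolding K_def by (intro someI)
    then have "K s' = D'" using D'(1) exec_deterministic by blast
    then show "rel_pmf (\<lambda>a (s', t'). R' a s' \<and> t' \<le> t2) (\<nu> a) (K s')" using D'(2) by simp
  qed
  have "exec q s' (K s')" if st: "(s', t') \<in> set_pmf D" for s' t'
  proof -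
    obtain a where "a \<in> set_pmf \<mu>" "R a s'"
      using rel_setD2[OF rel_pmf_imp_rel_set[OF D] st] by auto
    then show ?thesis by (rule K(1))
  qed
  moreover have "rel_pmf (\<lambda>a (s', t'). R' a s' \<and> t' \<le> t1 + t2) (bind_pmf \<mu> \<nu>) (and_then D K)"
    unfolding and_then_def
  proof (rule rel_pmf_bindI)
    show "rel_pmf (\<lambda>a (s', t'). a \<in> set_pmf \<mu> \<and> R a s' \<and> t' \<le> t1) \<mu> D"
      by (rule pmf.rel_mono_strong[OF D]) auto
    fix a st assume st: "case st of (s', t') \<Rightarrow> a \<in> set_pmf \<mu> \<and> R a s' \<and> t' \<le> t1"
    obtain s' t' where [simp]: "st = (s', t')" by (cases st)
    have "rel_pmf (\<lambda>a (s', t'). R' a s' \<and> t' \<le> t2) (\<nu> a) (K s')" using st by (intro K(2)) auto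
    then show "rel_pmf (\<lambda>a (s', t'). R' a s' \<and> t' \<le> t1 + t2) (\<nu> a) (case st of (s, t) \<Rightarrow> charge t (K s))"
      using st by (auto simp: charge_def pmf.rel_map elim!: pmf.rel_mono_strong)
  qed
  ultimately show ?thesis by blast
qed

lemma runs_Seq:
  assumes p: "runs p s t1 \<mu> R"
    and q: "\<And>a s'. a \<in> set_pmf \<mu> \<Longrightarrow> R a s' \<Longrightarrow> runs q s' t2 (\<nu> a) R'"
  shows "runs (Seq p q) s (t1 + t2) (bind_pmf \<mu> \<nu>) R'"
proof -
  obtain D where D: "exec p s D" "rel_pmf (\<lambda>a (s', t'). R a s' \<and> t' \<le> t1) \<mu> D"
    using p unfolding runs_def by blast
  obtain K where "\<forall>s' t'. (s', t') \<in> set_pmf D \<longrightarrow> exec q s' (K s')"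
    "rel_pmf (\<lambda>a (s', t'). R' a s' \<and> t' \<le> t1 + t2) (bind_pmf \<mu> \<nu>) (and_then D K)"
    using runs_continue[where \<nu> = \<nu>, OF D(2) q] by blast
  then show ?thesis unfolding runs_def using exec.Seq[OF D(1)] by blast
qed

lemma runs_Loop:
  assumes "bval s b" and p: "runs p s t1 \<mu> R"
    and q: "\<And>a s'. a \<in> set_pmf \<mu> \<Longrightarrow> R a s' \<Longrightarrow> runs (Loop b p) s' t2 (\<nu> a) R'"
  shows "runs (Loop b p) s (bcost b + (t1 + t2)) (bind_pmf \<mu> \<nu>) R'"
proof -
  obtain D where D: "exec p s D" "rel_pmf (\<lambda>a (s', t'). R a s' \<and> t' \<le> t1) \<mu> D"
    using p unfolding runs_def by blast
  obtain K where K: "\<forall>s' t'. (s', t') \<in> set_pmf D \<longrightarrow> exec (Loop b p) s' (K s')"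
    "rel_pmf (\<lambda>a (s', t'). R' a s' \<and> t' \<le> t1 + t2) (bind_pmf \<mu> \<nu>) (and_then D K)"
    using runs_continue[where \<nu> = \<nu>, OF D(2) q] by blast
  have "rel_pmf (\<lambda>a (s', t'). R' a s' \<and> t' \<le> bcost b + (t1 + t2)) (bind_pmf \<mu> \<nu>)
      (charge (bcost b) (and_then D K))"
    using K(2) by (auto simp: charge_def pmf.rel_map elim!: pmf.rel_mono_strong)
  then show ?thesis
    unfolding runs_def using exec.LoopTrue[OF assms(1) D(1)] K(1) by blast
qed

lemma runs_Toss:
  assumes "0 \<le> rval s a" "rval s a \<le> 1"
    and "\<And>b. R b (iupdate x (map (ival s) es) (of_bool b) s)"
  shows "runs (Toss x es a) s (1 + sum_list (map icost es) + rcost a) (bernoulli_pmf (rval s a)) R"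
  unfolding runs_def using exec.Toss[OF assms(1,2), of x es] assms(3)[of True] assms(3)[of False]
  by (intro exI conjI) (auto simp: pmf.rel_map intro!: rel_pmf_reflI)

section \<open>The abstract sampler and its distribution\<close>

definition inclusion_prob :: "real mat \<Rightarrow> int vec \<Rightarrow> int \<Rightarrow> nat set \<Rightarrow> nat \<Rightarrow> real" where
  "inclusion_prob L c C A i = weight L c C (insert i A) (Suc i) /
     (weight L c C A (Suc i) + weight L c C (insert i A) (Suc i))"

primrec extend :: "real mat \<Rightarrow> int vec \<Rightarrow> int \<Rightarrow> nat \<Rightarrow> nat \<Rightarrow> nat set \<Rightarrow> nat set pmf" where
  "extend L c C 0 i A = return_pmf A"
| "extend L c C (Suc n) i A = bind_pmf (bernoulli_pmf (inclusion_prob L c C A i))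
     (\<lambda>b. extend L c C n (Suc i) (if b then insert i A else A))"

text \<open>If both weights are 0, the quotient is 0 by the convention for division, which is still
  a legal bias.\<close>

lemma inclusion_prob_bounds:
  assumes "L \<in> carrier_mat (dim_vec c) (dim_vec c)" "positive_semidefinite L"
  shows "0 \<le> inclusion_prob L c C A i" "inclusion_prob L c C A i \<le> 1"
  using weight_nonneg[OF assms, of C A "Suc i"] weight_nonneg[OF assms, of C "insert i A" "Suc i"]
  unfolding inclusion_prob_def
  by (auto intro!: divide_nonneg_nonneg divide_le_eq_1[THEN iffD2])

text \<open>The branch that leads to \<open>B\<close> has probability (new weight / old weight), and
  by induction \<open>B\<close> then has probability (minor / new weight); the new weight
  cancels.\<close>

lemma pmf_extend:
  assumes L: "L \<in> carrier_mat (dim_vec c) (dim_vec c)" "positive_semidefinite L"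
    and "n + i = dim_vec c" "A \<subseteq> {..<i}" "0 < weight L c C A i"
  shows "pmf (extend L c C n i A) B =
    (if B \<in> feasible_sets c C \<and> B \<inter> {..<i} = A then principal_minor L B / weight L c C A i else 0)"
  using assms(3-)
proof (induction n arbitrary: i A)
  case 0
  then have i: "i = dim_vec c" by simp
  \<comment> \<open>A positive weight excludes the value 0 in \<open>weight_full\<close>.\<close>
  have A: "A \<in> feasible_sets c C" "weight L c C A i = principal_minor L A"
    using weight_full[of A c L C] 0 unfolding i by (auto split: if_splits)
  have eq: "B \<in> feasible_sets c C \<and> B \<inter> {..<i} = A \<longleftrightarrow> A = B"
    using A(1) i by (auto simp: feasible_sets_def)
  have "pmf (extend L c C 0 i A) B = (if A = B then 1 else 0)" by (simp add: indicator_def)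
  then show ?case unfolding eq using A(2) 0(3) by (cases "A = B") simp_all
next
  case (Suc n)
  let ?w = "weight L c C A i" and ?wout = "weight L c C A (Suc i)"
    and ?win = "weight L c C (insert i A) (Suc i)" and ?p = "inclusion_prob L c C A i"
  let ?val = "\<lambda>A i. if B \<in> feasible_sets c C \<and> B \<inter> {..<i} = A then principal_minor L B / weight L c C A i else 0"
  have w: "?w = ?wout + ?win" by (rule weight_split[OF Suc.prems(2)])
  have p: "?p = ?win / ?w" "1 - ?p = ?wout / ?w"
    using Suc.prems(3) w by (auto simp: inclusion_prob_def field_simps)
  \<comment> \<open>In a branch of weight 0 nothing can be cancelled, but there the minor of
    \<open>B\<close> vanishes, being nonnegative and at most the weight.\<close>
  have zero: "principal_minor L B = 0"
    if "weight L c C A' (Suc i) = 0" "B \<in> feasible_sets c C" "B \<inter> {..<Suc i} = A'" for A'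
  proof -
    have "principal_minor L B \<le> weight L c C A' (Suc i)"
      unfolding weight_def using that(2,3) finite_feasible_sets[of c C]
      by (intro member_le_sum) (auto intro!: principal_minor_nonneg[OF L] simp: feasible_sets_def atLeast0LessThan)
    moreover have "0 \<le> principal_minor L B"
      using that(2) by (intro principal_minor_nonneg[OF L]) (auto simp: feasible_sets_def atLeast0LessThan)
    ultimately show ?thesis using that(1) by simp
  qed
  have branch: "q * pmf (extend L c C n (Suc i) A') B
      = (if B \<in> feasible_sets c C \<and> B \<inter> {..<Suc i} = A' then principal_minor L B / ?w else 0)"
    if A': "A' \<subseteq> {..<Suc i}" and q: "q = weight L c C A' (Suc i) / ?w" for q A'
  proof (cases "weight L c C A' (Suc i) = 0")
    case True
    then show ?thesis using zero[OF True] q by auto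
  next
    case False
    then have "0 < weight L c C A' (Suc i)" using weight_nonneg[OF L, of C A' "Suc i"] by simp
    then show ?thesis using Suc.IH[of "Suc i" A'] Suc.prems A' q by auto
  qed
  have "pmf (extend L c C (Suc n) i A) B = ?p * pmf (extend L c C n (Suc i) (insert i A)) B
      + (1 - ?p) * pmf (extend L c C n (Suc i) A) B"
    using inclusion_prob_bounds[OF L, of C A i] by (simp add: pmf_bind)
  also have "\<dots> = (if B \<in> feasible_sets c C \<and> B \<inter> {..<Suc i} = insert i A then principal_minor L B / ?w else 0)
      + (if B \<in> feasible_sets c C \<and> B \<inter> {..<Suc i} = A then principal_minor L B / ?w else 0)"
    using Suc.prems(2) by (intro arg_cong2[where f = "(+)"] branch p) auto
  also have "\<dots> = ?val A i"
  proof -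
    have sum_if: "(if F \<and> X then v else 0) + (if F \<and> Y then v else 0) = (if F \<and> (Y \<or> X) then v else 0)"
      if "\<not> (X \<and> Y)" for F X Y and v :: real using that by auto
    show ?thesis
      unfolding inter_lessThan_Suc_iff[OF Suc.prems(2)] by (rule sum_if) (use Suc.prems(2) in auto)
  qed
  finally show ?case .
qed

definition setup_prog :: prog where
  "setup_prog = PSeq (PInt ''n'' [] (IConst 0))
    (PSeq (PFor ''j'' ''m'' (PCond (ILess (IVar ''c'' [V ''j'']) (IConst 0))
       (PInt ''n'' [] (ISub (V ''n'') (IVar ''c'' [V ''j''])))
       (PInt ''n'' [] (IAdd (V ''n'') (IVar ''c'' [V ''j''])))))
    (PSeq (PInt ''K'' [] (IAdd (IMul (IConst 2) (V ''n'')) (IConst 1)))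
    (PSeq (PInt ''M'' [] (IAdd (V ''m'') (IConst 1)))
    (PSeq (PInt ''N'' [] (IMul (V ''K'') (IMul (V ''M'') (V ''M''))))
    (PInt ''two'' [] (IConst 2))))))"

lemma setup_prog_syntax [simp]:
  "int_writes setup_prog = {''n'', ''j'', ''K'', ''M'', ''N'', ''two''}"
  "loop_bounds setup_prog = {''m''}" "proper setup_prog"
  by (auto simp: setup_prog_def)

lemma env_setup_prog:
  assumes L: "L \<in> carrier_mat (dim_vec c) (dim_vec c)"
  shows "env L c C (sem setup_prog (input_store L c C))"
proof -
  let ?s = "iupdate ''n'' [] 0 (input_store L c C)"
  define I where "I k s \<longleftrightarrow> agree {''n'', ''j''} {} (input_store L c C) s \<and>
    ints s ''n'' [] = (\<Sum>j<k. \<bar>vec_index c j\<bar>)" for k s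
  let ?loop = "PFor ''j'' ''m'' (PCond (ILess (IVar ''c'' [V ''j'']) (IConst 0))
       (PInt ''n'' [] (ISub (V ''n'') (IVar ''c'' [V ''j''])))
       (PInt ''n'' [] (IAdd (V ''n'') (IVar ''c'' [V ''j'']))))"
  have "I (dim_vec c) (sem ?loop ?s)"
  proof (rule sem_PFor)
    fix k s' assume "k < dim_vec c" "I k s'" "ints s' ''j'' [] = int k"
    then show "I (Suc k) (iupdate ''j'' [] (int (Suc k)) (sem (PCond (ILess (IVar ''c'' [V ''j'']) (IConst 0))
       (PInt ''n'' [] (ISub (V ''n'') (IVar ''c'' [V ''j''])))
       (PInt ''n'' [] (IAdd (V ''n'') (IVar ''c'' [V ''j''])))) s'))"
      by (auto simp: I_def agree_def input_store_def)
  qed (auto simp: I_def agree_def input_store_def)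
  then show ?thesis
    using L by (simp add: setup_prog_def env_def I_def agree_def input_store_def norm1_eq[symmetric]
        radix_def degree_bound_def algebra_simps)
qed

definition toss_com :: com where
  "toss_com = Toss ''S'' [V ''i''] (RDiv (RVar ''W'' [IConst 1])
     (RAdd (RVar ''W'' [IConst 0]) (RVar ''W'' [IConst 1])))"

definition step_com :: com where
  "step_com = Seq (compile step_prog) toss_com"

definition sampler :: com where
  "sampler = Seq (compile setup_prog) (for_com ''i'' ''m'' step_com)"

text \<open>\<open>degree_bound\<close> dominates the loop bounds \<open>m\<close> and
  \<open>M\<close>; the added 2 covers the bound \<open>two\<close>.\<close>

definition size_bound :: "nat \<Rightarrow> nat \<Rightarrow> nat" where
  "size_bound x y = (2 * y + 1) * ((x + 1) * (x + 1)) + 2"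

text \<open>The 10 units are the cost of \<open>toss_com\<close>.\<close>

definition step_time :: "nat \<Rightarrow> nat \<Rightarrow> nat" where
  "step_time x y = time_bound (size_bound x y) step_prog + 10"

definition sampler_time :: "nat \<Rightarrow> nat \<Rightarrow> nat" where
  "sampler_time x y = time_bound (size_bound x y) setup_prog + (2 + (x * (step_time x y + 7) + 3))"

lemma bivariate_sampler_time: "bivariate sampler_time"
proof -
  have B: "bivariate size_bound"
    unfolding size_bound_def by (intro bivariate_intros)
  show ?thesis
    unfolding sampler_time_def step_time_def by (intro bivariate_intros bivariate_time_bound B)
qed

definition partial_sample :: "real mat \<Rightarrow> int vec \<Rightarrow> int \<Rightarrow> nat \<Rightarrow> nat set \<Rightarrow> store \<Rightarrow> bool" where
  "partial_sample L c C i A s \<longleftrightarrow> env L c C s \<and> ints s ''i'' [] = int i \<and> A \<subseteq> {..<i} \<and>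
     (\<forall>j<i. ints s ''S'' [int j] = of_bool (j \<in> A))"

lemma env_loop_bounds:
  assumes "env L c C s" "n \<in> {''m'', ''M'', ''N'', ''two''}"
  shows "ints s n [] \<le> int (size_bound (dim_vec c) (norm1 c))"
proof -
  have "dim_vec c + 1 \<le> degree_bound c"
    unfolding degree_bound_def by simp
  then have "int (dim_vec c + 1) \<le> int (degree_bound c)" by (simp only: of_nat_le_iff)
  moreover have "int (size_bound (dim_vec c) (norm1 c)) = int (degree_bound c) + 2"
    by (simp add: size_bound_def degree_bound_def)
  ultimately show ?thesis using assms(2) envD(1,2,3,7)[OF assms(1)] by auto
qed

lemma runs_step_com:
  assumes L: "L \<in> carrier_mat (dim_vec c) (dim_vec c)" "positive_semidefinite L"
    and s: "partial_sample L c C i A s" and i: "i < dim_vec c"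
  shows "runs (Seq step_com (IAssign ''i'' [] (IAdd (V ''i'') (IConst 1)))) s
    (step_time (dim_vec c) (norm1 c) + 4) (bernoulli_pmf (inclusion_prob L c C A i))
    (\<lambda>b. partial_sample L c C (Suc i) (if b then insert i A else A))"
proof -
  let ?s = "sem step_prog s" and ?B = "size_bound (dim_vec c) (norm1 c)"
  have s': "env L c C s" "ints s ''i'' [] = int i" "A \<subseteq> {..<i}" "\<And>j. j < i \<Longrightarrow> ints s ''S'' [int j] = of_bool (j \<in> A)"
    using s by (auto simp: partial_sample_def)
  note step = sem_step_prog[OF L(1) s'(1,2) i s'(3,4)]
  have "\<exists>t. exec (compile step_prog) s (return_pmf (?s, t)) \<and> t \<le> time_bound ?B step_prog"
    by (rule exec_compile) (use env_loop_bounds[OF s'(1)] in auto)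
  \<comment> \<open>A deterministic part is coupled with the point distribution on the unit
    type.\<close>
  then have 1: "runs (compile step_prog) s (time_bound ?B step_prog) (return_pmf ()) (\<lambda>_ s'. s' = ?s)"
    by (auto intro: runs_return)
  let ?R = "\<lambda>b s'. s' = iupdate ''S'' [int i] (of_bool b) ?s"
  have p: "rval ?s (RDiv (RVar ''W'' [IConst 1]) (RAdd (RVar ''W'' [IConst 0]) (RVar ''W'' [IConst 1])))
      = inclusion_prob L c C A i"
    using step by (simp add: inclusion_prob_def)
  have 2: "runs toss_com ?s 10 (bernoulli_pmf (inclusion_prob L c C A i)) ?R"
    using runs_Toss[of ?s "RDiv (RVar ''W'' [IConst 1]) (RAdd (RVar ''W'' [IConst 0]) (RVar ''W'' [IConst 1]))"
        ?R "''S''" "[V ''i'']"] inclusion_prob_bounds[OF L, of C A i] step(2)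
    unfolding p toss_com_def by (simp add: numeral_eq_Suc)
  have 3: "runs step_com s (step_time (dim_vec c) (norm1 c)) (bernoulli_pmf (inclusion_prob L c C A i)) ?R"
    using runs_Seq[OF 1, of toss_com 10 "\<lambda>_. bernoulli_pmf (inclusion_prob L c C A i)" ?R] 2
    by (simp add: step_com_def step_time_def bind_return_pmf)
  have "runs (Seq step_com (IAssign ''i'' [] (IAdd (V ''i'') (IConst 1)))) s
    (step_time (dim_vec c) (norm1 c) + 4) (bind_pmf (bernoulli_pmf (inclusion_prob L c C A i)) return_pmf)
    (\<lambda>b. partial_sample L c C (Suc i) (if b then insert i A else A))"
  proof (rule runs_Seq[OF 3])
    fix b s' assume s'_eq: "s' = iupdate ''S'' [int i] (of_bool b) ?s"
    let ?A = "if b then insert i A else A"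
    have "partial_sample L c C (Suc i) ?A (iupdate ''i'' [] (int (Suc i)) s')"
      using step s'(3) by (auto simp: partial_sample_def s'_eq env_def less_Suc_eq)
    moreover have "exec (IAssign ''i'' [] (IAdd (V ''i'') (IConst 1))) s'
        (return_pmf (iupdate ''i'' [] (int (Suc i)) s', 4))"
      using exec.IAssign[of "''i''" "[]" "IAdd (V ''i'') (IConst 1)" s'] step(2)
      by (simp add: s'_eq numeral_eq_Suc add.commute)
    ultimately show "runs (IAssign ''i'' [] (IAdd (V ''i'') (IConst 1))) s' 4 (return_pmf b)
      (\<lambda>b. partial_sample L c C (Suc i) (if b then insert i A else A))"
      by (intro runs_return) auto
  qed
  then show ?thesis by (simp add: bind_return_pmf')
qed

lemma runs_main_loop:
  assumes L: "L \<in> carrier_mat (dim_vec c) (dim_vec c)" "positive_semidefinite L"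
    and "n + i = dim_vec c" "partial_sample L c C i A s"
  shows "runs (Loop (ILess (V ''i'') (V ''m'')) (Seq step_com (IAssign ''i'' [] (IAdd (V ''i'') (IConst 1))))) s
    (n * (step_time (dim_vec c) (norm1 c) + 7) + 3) (extend L c C n i A) (partial_sample L c C (dim_vec c))"
    (is "runs ?loop _ _ _ _")
  using assms(3-)
proof (induction n arbitrary: i A s)
  case 0
  then have "\<not> bval s (ILess (V ''i'') (V ''m''))" by (simp add: partial_sample_def env_def)
  from exec.LoopFalse[OF this] show ?case
    using 0 by (auto intro!: runs_return)
next
  case (Suc n)
  have b: "bval s (ILess (V ''i'') (V ''m''))" and i: "i < dim_vec c"
    using Suc.prems by (auto simp: partial_sample_def env_def)
  have "runs ?loop s (3 + ((step_time (dim_vec c) (norm1 c) + 4) + (n * (step_time (dim_vec c) (norm1 c) + 7) + 3)))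
     (extend L c C (Suc n) i A) (partial_sample L c C (dim_vec c))"
    unfolding extend.simps
    using runs_Loop[OF b runs_step_com[OF L Suc.prems(2) i] Suc.IH] Suc.prems(1)
    by (simp add: numeral_eq_Suc)
  then show ?case by (simp add: algebra_simps)
qed

lemma runs_sampler:
  assumes L: "L \<in> carrier_mat (dim_vec c) (dim_vec c)" "positive_semidefinite L"
  shows "runs sampler (input_store L c C) (sampler_time (dim_vec c) (norm1 c))
    (extend L c C (dim_vec c) 0 {}) (partial_sample L c C (dim_vec c))"
proof -
  let ?init = "input_store L c C" and ?B = "size_bound (dim_vec c) (norm1 c)"
  let ?s = "sem setup_prog ?init"
  have env: "env L c C ?s" by (rule env_setup_prog[OF L(1)])
  \<comment> \<open>\<open>env\<close> holds only after the setup, while the time bound for the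
    setup concerns \<open>m\<close> before it; the setup does not write \<open>m\<close>.\<close>
  have "ints ?s ''m'' = ints ?init ''m''" by (rule ints_sem_notin) simp
  then have "ints ?init ''m'' [] = int (dim_vec c)" using envD(1)[OF env] by simp
  then have "ints ?init ''m'' [] \<le> int ?B" using env_loop_bounds[OF env, of "''m''"] envD(1)[OF env] by simp
  then have "\<exists>t. exec (compile setup_prog) ?init (return_pmf (?s, t)) \<and> t \<le> time_bound ?B setup_prog"
    by (intro exec_compile) auto
  then have 1: "runs (compile setup_prog) ?init (time_bound ?B setup_prog) (return_pmf ()) (\<lambda>_ s'. s' = ?s)"
    by (auto intro: runs_return)
  have "exec (IAssign ''i'' [] (IConst 0)) ?s (return_pmf (iupdate ''i'' [] 0 ?s, 2))"
    using exec.IAssign[of "''i''" "[]" "IConst 0" ?s] by (simp add: numeral_2_eq_2)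
  then have 2: "runs (IAssign ''i'' [] (IConst 0)) ?s 2 (return_pmf ()) (\<lambda>_. partial_sample L c C 0 {})"
    using env by (intro runs_return) (auto simp: partial_sample_def env_def)
  have "runs (for_com ''i'' ''m'' step_com) ?s (2 + (dim_vec c * (step_time (dim_vec c) (norm1 c) + 7) + 3))
    (bind_pmf (return_pmf ()) (\<lambda>_. extend L c C (dim_vec c) 0 {})) (partial_sample L c C (dim_vec c))"
    unfolding for_com_def by (rule runs_Seq[OF 2 runs_main_loop[OF L]]) simp_all
  then have "runs sampler ?init (sampler_time (dim_vec c) (norm1 c))
    (bind_pmf (return_pmf ()) (\<lambda>_. extend L c C (dim_vec c) 0 {})) (partial_sample L c C (dim_vec c))"
    unfolding sampler_def sampler_time_def by (intro runs_Seq[OF 1]) (simp_all add: bind_return_pmf)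
  then show ?thesis by (simp add: bind_return_pmf)
qed

theorem corollary1p1:
  shows "\<exists>(p :: com) (P :: nat poly poly).
    \<forall>(m :: nat) (L :: real mat) (c :: int vec) (C :: int).
      L \<in> carrier_mat m m \<longrightarrow> positive_semidefinite L \<longrightarrow> c \<in> carrier_vec m \<longrightarrow>
      0 < normalizing_sum L c C \<longrightarrow>
      (\<exists>D. exec p (input_store L c C) D \<and>
         (\<forall>(s, t) \<in> set_pmf D. output_set m s \<in> feasible_sets c C \<and> t \<le> poly2 P m (norm1 c)) \<and>
         (\<forall>S \<in> feasible_sets c C.
            pmf (map_pmf (\<lambda>(s, t). output_set m s) D) S
              = principal_minor L S / normalizing_sum L c C))"
proof -
  obtain P where P: "\<And>x y. sampler_time x y = poly2 P x y"
    using bivariate_sampler_time unfolding bivariate_def by blast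
  have "\<exists>D. exec sampler (input_store L c C) D \<and>
         (\<forall>(s, t) \<in> set_pmf D. output_set m s \<in> feasible_sets c C \<and> t \<le> poly2 P m (norm1 c)) \<and>
         (\<forall>S \<in> feasible_sets c C.
            pmf (map_pmf (\<lambda>(s, t). output_set m s) D) S
              = principal_minor L S / normalizing_sum L c C)"
    if L: "L \<in> carrier_mat m m" "positive_semidefinite L" and c: "c \<in> carrier_vec m"
      and pos: "0 < normalizing_sum L c C" for m L c C
  proof -
    have m: "m = dim_vec c" using c by simp
    let ?\<mu> = "extend L c C m 0 {}"
    have \<mu>: "pmf ?\<mu> B = (if B \<in> feasible_sets c C then principal_minor L B / normalizing_sum L c C else 0)" for B
      using pmf_extend[OF L[unfolded m], of m 0 "{}" C B] pos by (simp add: m weight_zero)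
    obtain D where D: "exec sampler (input_store L c C) D"
      "rel_pmf (\<lambda>A (s, t). partial_sample L c C m A s \<and> t \<le> sampler_time m (norm1 c)) ?\<mu> D"
      using runs_sampler[OF L[unfolded m], of C] unfolding runs_def m by blast
    have out: "output_set m s = A" if "partial_sample L c C m A s" for A s
      using that by (auto simp: output_set_def partial_sample_def)
    \<comment> \<open>A coupled store determines its abstract set through \<open>output_set\<close>,
      so the coupling becomes an equality of distributions.\<close>
    have "rel_pmf (=) ?\<mu> (map_pmf (\<lambda>(s, t). output_set m s) D)"
      using D(2) unfolding pmf.rel_map by (rule pmf.rel_mono_strong) (auto simp: out)
    then have eq: "map_pmf (\<lambda>(s, t). output_set m s) D = ?\<mu>" by (simp add: pmf.rel_eq)
    have "output_set m s \<in> feasible_sets c C \<and> t \<le> poly2 P m (norm1 c)" if "(s, t) \<in> set_pmf D" for s t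
    proof
      have "output_set m s \<in> set_pmf ?\<mu>" unfolding eq[symmetric] using that by force
      then show "output_set m s \<in> feasible_sets c C"
        using \<mu>[of "output_set m s"] by (auto simp: set_pmf_iff split: if_splits)
      show "t \<le> poly2 P m (norm1 c)"
        using rel_pmf_imp_rel_set[OF D(2)] that by (force simp: rel_set_def P)
    qed
    then show ?thesis using D(1) \<mu> eq by (intro exI[of _ D]) auto
  qed
  then show ?thesis by blast
qed

end
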